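(* Let $a(t)=(t-2+\frac1t)^3$ and $q=\frac{n+3}{2}$. Then, as $n\to\infty$ (with remainder terms uniform in $j$): 1. For $j\in\{1,\dots,[\frac{n+1}{2}]\}$ with $\frac12 e^{\pi(j-1)}\le q^2$, $$\varphi_{2j-1}=d_{1,j}+\frac{2u_1^{\star}}{n+3}+\frac{4u_2^{\star}}{(n+3)^2}+O\left(\frac1{n^3}\right),$$ where $u_1^{\star}\in(-\frac\pi2,\frac\pi2)$ is the solution of the equation $u_1=\arctan\bigl(Z_1^{(1)}(u_1)\bigr)$ and $u_2^{\star}=R^{(1)}(u_1^{\star})$. 2. For $j\in\{1,\dots,[\frac n2]\}$ with $\frac12 e^{\pi(j-1)}\le q^2$, $$\varphi_{2j}=d_{2,j}+\frac{2w_1^{\star}}{n+3}+\frac{4w_2^{\star}}{(n+3)^2}+O\left(\frac1{n^3}\right),$$ where $w_1^{\star}\in(-\frac\pi2,\frac\pi2)$ is the solution of the equation $w_1=-\arctan\bigl(Z_1^{(2)}(w_1)\bigr)$ and $w_2^{\star}=R^{(2)}(w_1^{\star})$. The functions $Z_1^{(1)},R^{(1)},Z_1^{(2)},R^{(2)}$ are the explicit elementary functions given in the context.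
   Context: $d_{1,j}=\frac{2\pi j}{n+3}$, $d_{2,j}=\frac{(2j+1)\pi}{n+3}$; $[x]$ is the integer part of $x$. "Uniform in $j$" means that the constant in $O(1/n^3)$ does not depend on $j$. Definition of the $\varphi_m$. $\beta:[0,\pi]\to\mathbb C$ is the regular branch of $\arccos\bigl(1-(1-\cos\varphi)e^{2\pi i/3}\bigr)$ determined as follows: $\beta$ is continuous, $\beta(0)=0$, $\cos\beta(\varphi)=1-(1-\cos\varphi)e^{2\pi i/3}$, and for $\varphi\in(0,\pi)$ one has $\sin\beta(\varphi)=B_s(\varphi)e^{i\psi_s(\varphi)}$ with $B_s(\varphi)>0$ and $\psi_s(\varphi)\in(\frac{\pi}{4},\frac{\pi}{3})$. For $\varphi\in(0,\pi)$ put $c(\varphi)=\Re\beta(\varphi)$, $b(\varphi)=\Im\beta(\varphi)$, $B(\varphi)=\Re\bigl(\sin(\beta(\varphi))e^{-\pi i/3}\bigr)$, $C(\varphi)=-\Im\bigl(\sin(\beta(\varphi))e^{-\pi i/3}\bigr)$, and $$f(\varphi)=2\,\frac{B(\varphi)\sin((n+3)c(\varphi))+C(\varphi)\sinh((n+3)b(\varphi))}{\sin(\varphi)\,\bigl(\cos((n+3)c(\varphi))+\cosh((n+3)b(\varphi))\bigr)},$$ $$h(\varphi)=2\,\frac{B(\varphi)\sin((n+3)c(\varphi))-C(\varphi)\sinh((n+3)b(\varphi))}{\sin(\varphi)\,\bigl(-\cos((n+3)c(\varphi))+\cosh((n+3)b(\varphi))\bigr)}.$$ For $n$ sufficiently large,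 $\varphi_{2j-1}$ ($1\le j\le[\frac{n+1}{2}]$) denotes the unique root of $\tan(\frac{n+3}{2}\varphi)=f(\varphi)$ in $\left(\frac{\pi(2j-1)}{n+3},\frac{\pi(2j+1)}{n+3}\right)$, and $\varphi_{2j}$ ($1\le j\le[\frac n2]$) denotes the unique root of $\tan(\frac{n+3}{2}\varphi)=\frac1{h(\varphi)}$ in $\left(\frac{2\pi j}{n+3},\frac{2\pi(j+1)}{n+3}\right)$, the latter equation being understood as $\cos(\frac{n+3}{2}\varphi)=h(\varphi)\sin(\frac{n+3}{2}\varphi)$. (With $g(\varphi)=a(e^{i\varphi})$, the numbers $g(\varphi_m)$, $1\le m\le n$, are the eigenvalues of the $n\times n$ Toeplitz matrix with symbol $a$.) Functions with superscript $(1)$ (functions of $u_1\in(-\frac\pi2,\frac\pi2)$, with $d=d_{1,j}$): $P_a^{(1)}=qd+u_1$, $P_b^{(1)}=\sqrt3(qd+u_1)$, $B_1^{(1)}=1+\frac{3}{16}d^2$, $C_1^{(1)}=\frac{\sqrt3}{16}d^2$, $B_2^{(1)}=\frac{3du_1}{8}$, $C_2^{(1)}=\frac{\sqrt3du_1}{8}$, $Q_a^{(1)}=-\frac18(d^3q^2+3d^2u_1q+3du_1^2)$, $Q_b^{(1)}=-\frac{\sqrt3}{24}(d^3q^2+3d^2u_1q+3du_1^2)$, $$Z_1^{(1)}=2\,\frac{B_1^{(1)}\sin P_a^{(1)}+C_1^{(1)}\sinh P_b^{(1)}}{\cos P_a^{(1)}+\cosh P_b^{(1)}},$$ $$X_1^{(1)}=2\left(\frac{\sin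 P_a^{(1)}}{\cosh P_b^{(1)}}B_1^{(1)}+\frac{\sinh P_b^{(1)}}{\cosh P_b^{(1)}}C_1^{(1)}\right),$$ $$X_2^{(1)}=2\left(\frac{\sin P_a^{(1)}}{\cosh P_b^{(1)}}B_2^{(1)}+B_1^{(1)}\frac{Q_a^{(1)}\cos P_a^{(1)}}{\cosh P_b^{(1)}}+\frac{\sinh P_b^{(1)}}{\cosh P_b^{(1)}}C_2^{(1)}+C_1^{(1)}Q_b^{(1)}\right),$$ $$X_3^{(1)}=2\left(B_1^{(1)}\frac{\cos P_a^{(1)}}{\cosh P_b^{(1)}}+\sqrt3\,C_1^{(1)}\right),\qquad Y_1^{(1)}=1+\frac{\cos P_a^{(1)}}{\cosh P_b^{(1)}},$$ $$Y_2^{(1)}=-\frac{Q_a^{(1)}\sin P_a^{(1)}}{\cosh P_b^{(1)}}+\frac{Q_b^{(1)}\sinh P_b^{(1)}}{\cosh P_b^{(1)}},\qquad Y_3^{(1)}=-\frac{\sin P_a^{(1)}}{\cosh P_b^{(1)}}+\frac{\sqrt3\sinh P_b^{(1)}}{\cosh P_b^{(1)}}$$ (so $Z_1^{(1)}=X_1^{(1)}/Y_1^{(1)}$). Functions with superscript $(2)$ (functions of $w_1\in(-\frac\pi2,\frac\pi2)$, with $d=d_{2,j}$): $P_a^{(2)}=qd+w_1$, $P_b^{(2)}=\sqrt3(qd+w_1)$, $B_1^{(2)}=1+\frac{3}{16}d^2$, $C_1^{(2)}=\frac{\sqrt3}{16}d^2$, $B_2^{(2)}=\frac{3dw_1}{8}$,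 $C_2^{(2)}=\frac{\sqrt3dw_1}{8}$, $Q_a^{(2)}=-\frac18(d^3q^2+3d^2w_1q+3dw_1^2)$, $Q_b^{(2)}=-\frac{\sqrt3}{24}(d^3q^2+3d^2w_1q+3dw_1^2)$, $$Z_1^{(2)}=2\,\frac{B_1^{(2)}\sin P_a^{(2)}-C_1^{(2)}\sinh P_b^{(2)}}{-\cos P_a^{(2)}+\cosh P_b^{(2)}},$$ $$X_1^{(2)}=2\left(-\frac{\sin P_a^{(2)}}{\cosh P_b^{(2)}}B_1^{(2)}+\frac{\sinh P_b^{(2)}}{\cosh P_b^{(2)}}C_1^{(2)}\right),$$ $$X_2^{(2)}=2\left(-\frac{\sin P_a^{(2)}}{\cosh P_b^{(2)}}B_2^{(2)}-B_1^{(2)}\frac{Q_a^{(2)}\cos P_a^{(2)}}{\cosh P_b^{(2)}}+\frac{\sinh P_b^{(2)}}{\cosh P_b^{(2)}}C_2^{(2)}+C_1^{(2)}Q_b^{(2)}\right),$$ $$X_3^{(2)}=2\left(-B_1^{(2)}\frac{\cos P_a^{(2)}}{\cosh P_b^{(2)}}+\sqrt3\,C_1^{(2)}\right),\qquad Y_1^{(2)}=1-\frac{\cos P_a^{(2)}}{\cosh P_b^{(2)}},$$ $$Y_2^{(2)}=\frac{Q_a^{(2)}\sin P_a^{(2)}}{\cosh P_b^{(2)}}+\frac{Q_b^{(2)}\sinh P_b^{(2)}}{\cosh P_b^{(2)}},\qquad Y_3^{(2)}=\frac{\sin P_a^{(2)}}{\cosh P_b^{(2)}}+\frac{\sqrt3\sinh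 P_b^{(2)}}{\cosh P_b^{(2)}}$$ (so $Z_1^{(2)}=-X_1^{(2)}/Y_1^{(2)}$). For $i=1,2$: $$Z_2^{(i)}=\frac{X_2^{(i)}Y_1^{(i)}-X_1^{(i)}Y_2^{(i)}}{(Y_1^{(i)})^2},\qquad Z_3^{(i)}=\frac{X_3^{(i)}Y_1^{(i)}-X_1^{(i)}Y_3^{(i)}}{(Y_1^{(i)})^2},\qquad R^{(i)}=\frac{Z_2^{(i)}}{1+(Z_1^{(i)})^2-Z_3^{(i)}}.$$ For $n$ sufficiently large, under the stated condition on $j$, each of the equations for $u_1$ and $w_1$ has a unique solution in $(-\frac\pi2,\frac\pi2)$. *)

theory Defs
  imports "HOL-Analysis.Analysis"
begin

(* The Toeplitz symbol a(t) = (t - 2 + 1/t)^3 enters only through the branch beta: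
   a(exp(i phi)) = -8 (1 - cos phi)^3, so a(exp(i beta)) = a(exp(i phi)) holds iff
   (1 - cos beta)^3 = (1 - cos phi)^3, and beta is the solution belonging to the
   cube root of unity exp(2 pi i/3). *)

definition regular_branch :: "(real \<Rightarrow> complex) \<Rightarrow> bool" where
  "regular_branch \<beta> \<longleftrightarrow>
     continuous_on {0..pi} \<beta> \<and> \<beta> 0 = 0 \<and>
     (\<forall>\<phi>\<in>{0..pi}. cos (\<beta> \<phi>) = 1 - complex_of_real (1 - cos \<phi>) * cis (2 * pi / 3)) \<and>
     (\<forall>\<phi>\<in>{0<..<pi}. \<exists>B \<psi>. B > 0 \<and> pi / 4 < \<psi> \<and> \<psi> < pi / 3 \<and>
        sin (\<beta> \<phi>) = complex_of_real B * cis \<psi>)"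

(* The conditions determine the values of the branch on [0, pi], the only ones that matter;
   they are satisfied by beta(phi) = 2 arcsin (sin (phi/2) exp (pi i/3)). *)
definition beta :: "real \<Rightarrow> complex" where
  "beta = (SOME \<beta>. regular_branch \<beta>)"

definition c_fun :: "real \<Rightarrow> real" where
  "c_fun \<phi> = Re (beta \<phi>)"

definition b_fun :: "real \<Rightarrow> real" where
  "b_fun \<phi> = Im (beta \<phi>)"

definition B_fun :: "real \<Rightarrow> real" where
  "B_fun \<phi> = Re (sin (beta \<phi>) * cis (- (pi / 3)))"

definition C_fun :: "real \<Rightarrow> real" where
  "C_fun \<phi> = - Im (sin (beta \<phi>) * cis (- (pi / 3)))"

definition f_fun :: "nat \<Rightarrow> real \<Rightarrow> real" where
  "f_fun n \<phi> =
     2 * ((B_fun \<phi> * sin ((real n + 3) * c_fun \<phi>) + C_fun \<phi> * sinh ((real n + 3) * b_fun \<phi>)) /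
          (sin \<phi> * (cos ((real n + 3) * c_fun \<phi>) + cosh ((real n + 3) * b_fun \<phi>))))"

definition h_fun :: "nat \<Rightarrow> real \<Rightarrow> real" where
  "h_fun n \<phi> =
     2 * ((B_fun \<phi> * sin ((real n + 3) * c_fun \<phi>) - C_fun \<phi> * sinh ((real n + 3) * b_fun \<phi>)) /
          (sin \<phi> * (- cos ((real n + 3) * c_fun \<phi>) + cosh ((real n + 3) * b_fun \<phi>))))"

(* For m = 2j - 1 the interval is (pi (2j-1)/(n+3), pi (2j+1)/(n+3)), for m = 2j it is
   (2 pi j/(n+3), 2 pi (j+1)/(n+3)).  For even m the equation tan = 1/h is cleared of
   denominators, so that zeros of h are allowed. *)
definition phi :: "nat \<Rightarrow> nat \<Rightarrow> real" where
  "phi n m =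
     (THE \<phi>. pi * real m / (real n + 3) < \<phi> \<and> \<phi> < pi * (real m + 2) / (real n + 3) \<and>
        (if odd m
         then tan ((real n + 3) / 2 * \<phi>) = f_fun n \<phi>
         else cos ((real n + 3) / 2 * \<phi>) = h_fun n \<phi> * sin ((real n + 3) / 2 * \<phi>)))"

definition d1 :: "nat \<Rightarrow> nat \<Rightarrow> real" where
  "d1 n j = 2 * pi * real j / (real n + 3)"

definition d2 :: "nat \<Rightarrow> nat \<Rightarrow> real" where
  "d2 n j = (2 * real j + 1) * pi / (real n + 3)"

(* The superscripts (1) and (2) are rendered by the suffixes _I and _II.  P, B, C and Q are
   given by the same formulas in both cases, with d = d1 n j, u = u_1 resp. d = d2 n j, u = w_1. *)

definition Pa :: "real \<Rightarrow> real \<Rightarrow> real \<Rightarrow> real" where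
  "Pa q d u = q * d + u"

definition Pb :: "real \<Rightarrow> real \<Rightarrow> real \<Rightarrow> real" where
  "Pb q d u = sqrt 3 * (q * d + u)"

definition B1 :: "real \<Rightarrow> real" where
  "B1 d = 1 + 3 / 16 * d\<^sup>2"

definition C1 :: "real \<Rightarrow> real" where
  "C1 d = sqrt 3 / 16 * d\<^sup>2"

definition B2 :: "real \<Rightarrow> real \<Rightarrow> real" where
  "B2 d u = 3 * d * u / 8"

definition C2 :: "real \<Rightarrow> real \<Rightarrow> real" where
  "C2 d u = sqrt 3 * d * u / 8"

definition Qa :: "real \<Rightarrow> real \<Rightarrow> real \<Rightarrow> real" where
  "Qa q d u = - (1 / 8) * (d ^ 3 * q\<^sup>2 + 3 * d\<^sup>2 * u * q + 3 * d * u\<^sup>2)"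

definition Qb :: "real \<Rightarrow> real \<Rightarrow> real \<Rightarrow> real" where
  "Qb q d u = - (sqrt 3 / 24) * (d ^ 3 * q\<^sup>2 + 3 * d\<^sup>2 * u * q + 3 * d * u\<^sup>2)"

definition Z1_I :: "real \<Rightarrow> real \<Rightarrow> real \<Rightarrow> real" where
  "Z1_I q d u =
     2 * ((B1 d * sin (Pa q d u) + C1 d * sinh (Pb q d u)) / (cos (Pa q d u) + cosh (Pb q d u)))"

definition X1_I :: "real \<Rightarrow> real \<Rightarrow> real \<Rightarrow> real" where
  "X1_I q d u =
     2 * (sin (Pa q d u) / cosh (Pb q d u) * B1 d + sinh (Pb q d u) / cosh (Pb q d u) * C1 d)"

definition X2_I :: "real \<Rightarrow> real \<Rightarrow> real \<Rightarrow> real" where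
  "X2_I q d u =
     2 * (sin (Pa q d u) / cosh (Pb q d u) * B2 d u
        + B1 d * (Qa q d u * cos (Pa q d u) / cosh (Pb q d u))
        + sinh (Pb q d u) / cosh (Pb q d u) * C2 d u
        + C1 d * Qb q d u)"

definition X3_I :: "real \<Rightarrow> real \<Rightarrow> real \<Rightarrow> real" where
  "X3_I q d u = 2 * (B1 d * (cos (Pa q d u) / cosh (Pb q d u)) + sqrt 3 * C1 d)"

definition Y1_I :: "real \<Rightarrow> real \<Rightarrow> real \<Rightarrow> real" where
  "Y1_I q d u = 1 + cos (Pa q d u) / cosh (Pb q d u)"

definition Y2_I :: "real \<Rightarrow> real \<Rightarrow> real \<Rightarrow> real" where
  "Y2_I q d u =
     - (Qa q d u * sin (Pa q d u) / cosh (Pb q d u)) + Qb q d u * sinh (Pb q d u) / cosh (Pb q d u)"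

definition Y3_I :: "real \<Rightarrow> real \<Rightarrow> real \<Rightarrow> real" where
  "Y3_I q d u =
     - (sin (Pa q d u) / cosh (Pb q d u)) + sqrt 3 * sinh (Pb q d u) / cosh (Pb q d u)"

definition Z1_II :: "real \<Rightarrow> real \<Rightarrow> real \<Rightarrow> real" where
  "Z1_II q d w =
     2 * ((B1 d * sin (Pa q d w) - C1 d * sinh (Pb q d w)) / (- cos (Pa q d w) + cosh (Pb q d w)))"

definition X1_II :: "real \<Rightarrow> real \<Rightarrow> real \<Rightarrow> real" where
  "X1_II q d w =
     2 * (- (sin (Pa q d w) / cosh (Pb q d w) * B1 d) + sinh (Pb q d w) / cosh (Pb q d w) * C1 d)"

definition X2_II :: "real \<Rightarrow> real \<Rightarrow> real \<Rightarrow> real" where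
  "X2_II q d w =
     2 * (- (sin (Pa q d w) / cosh (Pb q d w) * B2 d w)
        - B1 d * (Qa q d w * cos (Pa q d w) / cosh (Pb q d w))
        + sinh (Pb q d w) / cosh (Pb q d w) * C2 d w
        + C1 d * Qb q d w)"

definition X3_II :: "real \<Rightarrow> real \<Rightarrow> real \<Rightarrow> real" where
  "X3_II q d w = 2 * (- (B1 d * (cos (Pa q d w) / cosh (Pb q d w))) + sqrt 3 * C1 d)"

definition Y1_II :: "real \<Rightarrow> real \<Rightarrow> real \<Rightarrow> real" where
  "Y1_II q d w = 1 - cos (Pa q d w) / cosh (Pb q d w)"

definition Y2_II :: "real \<Rightarrow> real \<Rightarrow> real \<Rightarrow> real" where
  "Y2_II q d w =
     Qa q d w * sin (Pa q d w) / cosh (Pb q d w) + Qb q d w * sinh (Pb q d w) / cosh (Pb q d w)"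

definition Y3_II :: "real \<Rightarrow> real \<Rightarrow> real \<Rightarrow> real" where
  "Y3_II q d w =
     sin (Pa q d w) / cosh (Pb q d w) + sqrt 3 * sinh (Pb q d w) / cosh (Pb q d w)"

definition Z2_I :: "real \<Rightarrow> real \<Rightarrow> real \<Rightarrow> real" where
  "Z2_I q d u = (X2_I q d u * Y1_I q d u - X1_I q d u * Y2_I q d u) / (Y1_I q d u)\<^sup>2"

definition Z3_I :: "real \<Rightarrow> real \<Rightarrow> real \<Rightarrow> real" where
  "Z3_I q d u = (X3_I q d u * Y1_I q d u - X1_I q d u * Y3_I q d u) / (Y1_I q d u)\<^sup>2"

definition R_I :: "real \<Rightarrow> real \<Rightarrow> real \<Rightarrow> real" where
  "R_I q d u = Z2_I q d u / (1 + (Z1_I q d u)\<^sup>2 - Z3_I q d u)"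

definition Z2_II :: "real \<Rightarrow> real \<Rightarrow> real \<Rightarrow> real" where
  "Z2_II q d w = (X2_II q d w * Y1_II q d w - X1_II q d w * Y2_II q d w) / (Y1_II q d w)\<^sup>2"

definition Z3_II :: "real \<Rightarrow> real \<Rightarrow> real \<Rightarrow> real" where
  "Z3_II q d w = (X3_II q d w * Y1_II q d w - X1_II q d w * Y3_II q d w) / (Y1_II q d w)\<^sup>2"

definition R_II :: "real \<Rightarrow> real \<Rightarrow> real \<Rightarrow> real" where
  "R_II q d w = Z2_II q d w / (1 + (Z1_II q d w)\<^sup>2 - Z3_II q d w)"

definition qn :: "nat \<Rightarrow> real" where
  "qn n = (real n + 3) / 2"

definition u1_star :: "nat \<Rightarrow> nat \<Rightarrow> real" where
  "u1_star n j = (THE u. - (pi / 2) < u \<and> u < pi / 2 \<and> u = arctan (Z1_I (qn n) (d1 n j) u))"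

definition u2_star :: "nat \<Rightarrow> nat \<Rightarrow> real" where
  "u2_star n j = R_I (qn n) (d1 n j) (u1_star n j)"

definition w1_star :: "nat \<Rightarrow> nat \<Rightarrow> real" where
  "w1_star n j = (THE w. - (pi / 2) < w \<and> w < pi / 2 \<and> w = - arctan (Z1_II (qn n) (d2 n j) w))"

definition w2_star :: "nat \<Rightarrow> nat \<Rightarrow> real" where
  "w2_star n j = R_II (qn n) (d2 n j) (w1_star n j)"

end

theory Submission
  imports Defs "HOL-Real_Asymp.Real_Asymp"
begin

text \<open>
Put q = (n + 3)/2 and write \<phi> = d + u/q with |u| < pi/2, where q d = pi j for the roots of odd index
and q d = pi j + pi/2 for those of even index.  By periodicity of the tangent the equation for \<phi> becomes
u = arctan (F(d + u/q)) with F = f or F = -h, while the first coefficient solves u = arctan (Z(u)) with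
Z = Z1 or Z = -Z1.  So the task is to compare the fixed points of two maps.

Both maps have one shape.  Let \<omega> = exp(i pi/3), G = sin \<beta> / (\<omega> sin \<phi>) and \<sigma> = 1 for f, \<sigma> = -1 for -h.
Since (sin \<xi> + i sinh \<eta>) / (cos \<xi> + cosh \<eta>) is the tangent of (\<xi> + i \<eta>)/2, the functions f and -h are
2 Re (G tan(q \<beta>)) and -2 Re (G cot(q \<beta>)), that is,
  4 Im (G w / (1 + w)) - 2 Im G   with   w = \<sigma> exp(2 i q \<beta>)
(lemmas \<open>tan_like_eq\<close>, \<open>f_fun_eq_exact_rhs\<close>, \<open>minus_h_fun_eq_exact_rhs\<close>).  The function Z arises from the same
formula when \<beta>(\<phi>) is replaced by \<omega> \<phi> and G by the Taylor polynomial 1 + (1 - \<omega>^2) d^2/8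
(lemma \<open>model_rhs_eq\<close>).

Contraction.  Put x = q d + u; then x \<ge> pi/2 and |w| is close to exp(- sqrt 3 x), in any case at most 1/12.
Because \<beta>' = \<omega>/G, the leading part of the derivative in u is 4 Im (2 i \<omega> w / (1 + w)^2), from which G has
disappeared; it is smaller than 4/5.  So both maps are contractions with constant 9/10
(\<open>exact_rhs_derivative\<close>, \<open>model_rhs_derivative\<close>).  This yields existence and uniqueness of both solutions, and
their distance is at most ten times the difference of F and Z at the solution of u = arctan (Z(u)).

Size of the difference.  The condition on j gives q d = O(log q), so x^5 \<le> q for large n.  The exponents
2 q \<beta>(x/q) and 2 \<omega> x differ by O(x^3/q^2), but the change is multiplied by exp(-x), which leaves O(1/q^2).
Outside the exponentials only Im G enters; there the error comes from (x/q)^2 - d^2 = (2 q d u + u^2)/q^2.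
At the solution of u = arctan (Z(u)) one has u = O(exp(-x) + x^2/q^2), so q d u is bounded
(\<open>model_fixed_point_small\<close>) and this error is O(1/q^2) too (\<open>exact_minus_model_le\<close>).  Therefore
d + u/q approximates the root up to O(1/q^3), uniformly in j.

Finally, the second coefficient Z2 / (1 + Z1^2 - Z3) is O(1/q) for the same reasons.  Its denominator is at least
1/10, since Z3 is the derivative of Z and hence at most 9/10
(\<open>second_order_numerator_le\<close>, \<open>model_derivative_le\<close>).  So the term 4 R / (n + 3)^2 is within the error.
\<close>

section \<open>The regular branch of the inverse cosine\<close>

abbreviation \<omega> :: complex where
  "\<omega> \<equiv> cis (pi / 3)"

text \<open>The square of \<omega> is the cube root of unity in the equation of the branch, and
  \<kappa> is the coefficient through which it enters the expansions below.\<close>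

abbreviation \<kappa> :: complex where
  "\<kappa> \<equiv> 1 - \<omega>\<^sup>2"

text \<open>Since 1 - cos \<phi> = 2 sin(\<phi>/2)^2, the equation of the branch says
  sin(\<beta>/2)^2 = (sin(\<phi>/2) \<omega>)^2.\<close>

definition branch :: "real \<Rightarrow> complex" where
  "branch \<phi> = 2 * Arcsin (of_real (sin (\<phi> / 2)) * \<omega>)"

text \<open>This is sin \<beta> / (\<omega> sin \<phi>), hence B - iC divided by sin \<phi>.  It is written as
  a function of the half-angle tangent because then its square is an affine function of the
  squared tangent, from which all size estimates follow.\<close>

definition ratio :: "real \<Rightarrow> complex" where
  "ratio \<phi> = csqrt (1 + \<kappa> * of_real ((tan (\<phi> / 2))\<^sup>2))"

lemma omega_eq: "\<omega> = Complex (1 / 2) (sqrt 3 / 2)"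
  by (simp add: complex_eq_iff cos_60 sin_60)

lemma omega_sq: "\<omega>\<^sup>2 = cis (2 * pi / 3)"
  by (simp add: power2_eq_square cis_mult)

lemma kappa_eq: "\<kappa> = Complex (3 / 2) (- sqrt 3 / 2)"
  by (simp add: complex_eq_iff omega_eq power2_eq_square)

lemma norm_kappa: "norm \<kappa> = sqrt 3"
  unfolding kappa_eq by (simp add: cmod_def power2_eq_square)

lemma norm_kappa_le: "norm \<kappa> \<le> 2"
  unfolding norm_kappa by (rule real_le_lsqrt) auto

lemma ratio_radicand:
  "Re (1 + \<kappa> * of_real (t\<^sup>2)) = 1 + 3 / 2 * t\<^sup>2"
  "Im (1 + \<kappa> * of_real (t\<^sup>2)) = - (sqrt 3 / 2) * t\<^sup>2"
  unfolding kappa_eq by simp_all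

lemma ratio_sq: "(ratio \<phi>)\<^sup>2 = 1 + \<kappa> * of_real ((tan (\<phi> / 2))\<^sup>2)"
  by (simp add: ratio_def)

lemma ratio_radicand_pos: "1 + \<kappa> * of_real (t\<^sup>2) \<notin> \<real>\<^sub>\<le>\<^sub>0"
proof
  assume "1 + \<kappa> * of_real (t\<^sup>2) \<in> \<real>\<^sub>\<le>\<^sub>0"
  then have "Re (1 + \<kappa> * of_real (t\<^sup>2)) \<le> 0"
    by (simp add: complex_nonpos_Reals_iff)
  then show False
    unfolding ratio_radicand using zero_le_power2[of t] by linarith
qed

lemma norm_ratio_ge: "1 \<le> norm (ratio \<phi>)"
proof -
  have "1 \<le> Re ((ratio \<phi>)\<^sup>2)"
    unfolding ratio_sq ratio_radicand by simp
  also have "\<dots> \<le> norm ((ratio \<phi>)\<^sup>2)"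
    by (rule complex_Re_le_cmod)
  finally have "1\<^sup>2 \<le> (norm (ratio \<phi>))\<^sup>2"
    by (simp add: norm_power)
  then show ?thesis
    by (rule power2_le_imp_le) simp
qed

lemma ratio_nonzero: "ratio \<phi> \<noteq> 0"
  using norm_ratio_ge[of \<phi>] by auto

text \<open>The principal square root lies in the closed right half plane, and on the
  imaginary axis its square would have a nonpositive real part.\<close>

lemma Re_ratio_pos: "0 < Re (ratio \<phi>)"
proof (rule ccontr)
  assume "\<not> ?thesis"
  then have "Re (ratio \<phi>) = 0"
    unfolding ratio_def using csqrt_principal by (metis)
  then have "Re ((ratio \<phi>)\<^sup>2) \<le> 0"
    by (simp add: power2_eq_square)
  then have "1 + 3 / 2 * (tan (\<phi> / 2))\<^sup>2 \<le> 0"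
    unfolding ratio_sq ratio_radicand .
  then show False
    using zero_le_power2[of "tan (\<phi> / 2)"] by linarith
qed

lemma cos_half_pos: "0 < cos (\<phi> / 2)" if "0 \<le> \<phi>" "\<phi> < pi"
  using that by (intro cos_gt_zero_pi) auto

text \<open>The squares agree because 1 - s^2 \<omega>^2 = c^2 + s^2 \<kappa> for
  s = sin(\<phi>/2), c = cos(\<phi>/2); positivity of the real parts selects the sign of the root.\<close>

lemma cos_Arcsin_ratio:
  assumes "0 \<le> \<phi>" "\<phi> < pi"
  shows "cos (Arcsin (of_real (sin (\<phi> / 2)) * \<omega>)) = of_real (cos (\<phi> / 2)) * ratio \<phi>"
proof -
  let ?s = "sin (\<phi> / 2)" and ?k = "cos (\<phi> / 2)"
  have k: "0 < ?k"
    using assms by (rule cos_half_pos)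
  have s: "0 \<le> ?s"
    using assms by (intro sin_ge_zero) auto
  have "cos (Arcsin (of_real ?s * \<omega>)) = csqrt (1 - (of_real ?s * \<omega>)\<^sup>2)"
    using s by (intro cos_Arcsin) (auto simp: cos_60 sin_60)
  also have "\<dots> = of_real ?k * ratio \<phi>"
  proof (rule csqrt_unique)
    have "(of_real ?k * ratio \<phi>)\<^sup>2 = of_real (?k\<^sup>2) * (1 + \<kappa> * of_real ((tan (\<phi> / 2))\<^sup>2))"
      by (simp add: power_mult_distrib ratio_sq)
    also have "\<dots> = of_real (?k\<^sup>2) + \<kappa> * of_real ((?k * tan (\<phi> / 2))\<^sup>2)"
      by (simp add: algebra_simps power_mult_distrib)
    also have "?k * tan (\<phi> / 2) = ?s"
      using k by (simp add: tan_def)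
    also have "of_real (?k\<^sup>2) + \<kappa> * of_real (?s\<^sup>2) = of_real (?k\<^sup>2 + ?s\<^sup>2) - (of_real ?s * \<omega>)\<^sup>2"
      by (simp add: algebra_simps power_mult_distrib del: sin_cos_squared_add sin_cos_squared_add2)
    also have "?k\<^sup>2 + ?s\<^sup>2 = 1"
      by simp
    finally show "(of_real ?k * ratio \<phi>)\<^sup>2 = 1 - (of_real ?s * \<omega>)\<^sup>2"
      by (simp only: of_real_1)
  qed (use k Re_ratio_pos[of \<phi>] in auto)
  finally show ?thesis .
qed

lemma cos_branch: "cos (branch \<phi>) = 1 - of_real (1 - cos \<phi>) * cis (2 * pi / 3)"
proof -
  have "cos \<phi> = 1 - 2 * (sin (\<phi> / 2))\<^sup>2"
    using cos_double_sin[of "\<phi> / 2"] by simp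
  then show ?thesis
    unfolding branch_def cos_double_sin sin_Arcsin omega_sq[symmetric]
    by (simp add: power_mult_distrib)
qed

lemma sin_branch:
  assumes "0 \<le> \<phi>" "\<phi> < pi"
  shows "sin (branch \<phi>) = of_real (sin \<phi>) * \<omega> * ratio \<phi>"
proof -
  have "sin \<phi> = 2 * sin (\<phi> / 2) * cos (\<phi> / 2)"
    using sin_double[of "\<phi> / 2"] by simp
  then show ?thesis
    unfolding branch_def sin_double sin_Arcsin cos_Arcsin_ratio[OF assms]
    by simp
qed

lemma Arcsin_argument_in_domain:
  assumes "0 \<le> \<phi>" "\<phi> \<le> pi" "Im (of_real (sin (\<phi> / 2)) * \<omega>) = 0"
  shows "\<bar>Re (of_real (sin (\<phi> / 2)) * \<omega>)\<bar> < 1"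
  using assms(3) by (auto simp: cos_60 sin_60)

text \<open>Differentiating cos \<beta> = 1 - (1 - cos \<phi>) \<omega>^2 gives \<beta>' sin \<beta> = \<omega>^2 sin \<phi>, that
  is, \<beta>' = \<omega> / ratio.  This reciprocal relation is what later cancels the ratio from the leading
  term of the derivative of the right-hand side.\<close>

lemma branch_has_vector_derivative:
  assumes "0 \<le> \<phi>" "\<phi> < pi"
  shows "(branch has_vector_derivative \<omega> / ratio \<phi>) (at \<phi>)"
proof -
  let ?F = "\<lambda>z. 2 * Arcsin (sin (z / 2) * \<omega>)"
  have k: "of_real (cos (\<phi> / 2)) \<noteq> (0 :: complex)"
    using cos_half_pos[OF assms] by simp
  have arg: "of_real (sin (\<phi> / 2)) = sin (of_real \<phi> / 2 :: complex)"
    "of_real (cos (\<phi> / 2)) = cos (of_real \<phi> / 2 :: complex)"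
    by (simp_all flip: sin_of_real cos_of_real)
  have "(?F has_field_derivative
          2 * (inverse (cos (Arcsin (sin (of_real \<phi> / 2) * \<omega>))) * (cos (of_real \<phi> / 2) * (1 / 2) * \<omega>)))
        (at (of_real \<phi>))"
    by (rule derivative_eq_intros refl
        Arcsin_argument_in_domain[OF assms(1) less_imp_le[OF assms(2)], unfolded arg] | assumption | simp)+
  also have "2 * (inverse (cos (Arcsin (sin (of_real \<phi> / 2) * \<omega>))) * (cos (of_real \<phi> / 2) * (1 / 2) * \<omega>))
     = \<omega> / ratio \<phi>"
    using cos_Arcsin_ratio[OF assms] k ratio_nonzero[of \<phi>]
    unfolding arg by (simp add: field_simps)
  finally have "((\<lambda>x. ?F (of_real x)) has_vector_derivative \<omega> / ratio \<phi>) (at \<phi>)"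
    by (rule has_vector_derivative_real_field)
  moreover have "(\<lambda>x. ?F (of_real x)) = branch"
    unfolding branch_def by (simp add: fun_eq_iff flip: sin_of_real)
  ultimately show ?thesis
    by simp
qed

lemma ratio_has_vector_derivative:
  assumes "0 \<le> \<phi>" "\<phi> < pi"
  shows "(ratio has_vector_derivative
           \<kappa> * of_real (tan (\<phi> / 2) * (1 + (tan (\<phi> / 2))\<^sup>2) / 2) / ratio \<phi>) (at \<phi>)"
proof -
  let ?F = "\<lambda>z::complex. csqrt (1 + \<kappa> * (tan (z / 2))\<^sup>2)"
  have k: "cos (of_real \<phi> / 2 :: complex) \<noteq> 0"
    using cos_half_pos[OF assms] cos_of_real[of "\<phi> / 2", where 'a = complex] by auto
  have tan_half: "tan (of_real x / 2 :: complex) = of_real (tan (x / 2))" for x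
    using tan_of_real[of "x / 2", where 'a = complex] by simp
  have F: "csqrt (1 + \<kappa> * (of_real (tan (x / 2)))\<^sup>2) = ratio x" for x
    unfolding ratio_def by simp
  have pos: "1 + \<kappa> * (tan (of_real \<phi> / 2))\<^sup>2 \<notin> \<real>\<^sub>\<le>\<^sub>0"
    using ratio_radicand_pos[of "tan (\<phi> / 2)"] unfolding tan_half by simp
  have inv: "inverse ((cos (of_real \<phi> / 2 :: complex))\<^sup>2) = of_real (1 + (tan (\<phi> / 2))\<^sup>2)"
    using tan_sec[OF k] unfolding tan_half by (simp add: power_inverse)
  have "(?F has_field_derivative
          \<kappa> * (2 * tan (of_real \<phi> / 2) * (inverse ((cos (of_real \<phi> / 2))\<^sup>2) * (1 / 2)))
             / (2 * ?F (of_real \<phi>))) (at (of_real \<phi>))"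
    using pos k by (auto intro!: derivative_eq_intros)
  then have "((\<lambda>x. ?F (of_real x)) has_vector_derivative
          \<kappa> * (2 * tan (of_real \<phi> / 2) * (inverse ((cos (of_real \<phi> / 2))\<^sup>2) * (1 / 2)))
             / (2 * ?F (of_real \<phi>))) (at \<phi>)"
    by (rule has_vector_derivative_real_field)
  then show ?thesis
    unfolding inv tan_half F by (simp add: mult_ac)
qed

text \<open>The only delicate point is the argument of sin \<beta>, which is pi/3 plus the argument
  \<theta> of the ratio.  The imaginary part of the squared ratio is negative, so \<theta> < 0.  Rotating
  the square by pi/6 turns its nonconstant term real and leaves imaginary part 1/2, which
  excludes \<theta> \<le> -pi/12.\<close>

lemma regular_branch_branch: "regular_branch branch"
  unfolding regular_branch_def
proof (intro conjI ballI)
  show "continuous_on {0..pi} branch"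
    unfolding branch_def
    by (intro continuous_intros continuous_on_compose2[OF continuous_on_Arcsin[of "{z. Im z = 0 \<longrightarrow> \<bar>Re z\<bar> < 1}"]])
      (auto simp: cos_60 sin_60)
  show "branch 0 = 0"
    by (simp add: branch_def)
  show "cos (branch \<phi>) = 1 - of_real (1 - cos \<phi>) * cis (2 * pi / 3)" for \<phi>
    by (rule cos_branch)
next
  fix \<phi> assume "\<phi> \<in> {0<..<pi}"
  then have \<phi>: "0 < \<phi>" "\<phi> < pi"
    by auto
  define t where "t = tan (\<phi> / 2)"
  have t: "0 < t"
    unfolding t_def using \<phi> by (intro tan_gt_zero) auto
  define \<theta> where "\<theta> = Arg (ratio \<phi>)"
  define r where "r = norm (ratio \<phi>)"
  have r: "0 < r"
    using ratio_nonzero by (simp add: r_def)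
  have polar: "ratio \<phi> = of_real r * cis \<theta>"
    unfolding r_def \<theta>_def using rcis_cmod_Arg[of "ratio \<phi>"] by (simp add: rcis_def)
  have sq: "of_real (r\<^sup>2) * cis (2 * \<theta>) = 1 + \<kappa> * of_real (t\<^sup>2)"
    using ratio_sq[of \<phi>] unfolding polar t_def by (simp add: power_mult_distrib Complex.DeMoivre)
  have "Im (of_real (r\<^sup>2) * cis (2 * \<theta>)) < 0"
    unfolding sq ratio_radicand using t by simp
  then have sin_neg: "sin (2 * \<theta>) < 0"
    using r by (simp add: mult_less_0_iff not_less)
  have half: "\<bar>\<theta>\<bar> < pi / 2"
    unfolding \<theta>_def Arg_Re_pos using Re_ratio_pos by simp
  have neg: "\<theta> < 0"
  proof (rule ccontr)
    assume "\<not> \<theta> < 0"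
    then have "0 \<le> sin (2 * \<theta>)"
      using half by (intro sin_ge_zero) auto
    with sin_neg show False by simp
  qed
  (* Multiplying the square of the ratio by cis (pi / 6) makes the term with t real. *)
  have "\<kappa> * cis (pi / 6) = of_real (sqrt 3)"
    by (simp add: complex_eq_iff kappa_eq cos_30 sin_30 algebra_simps)
  then have "cis (pi / 6) + (\<kappa> * cis (pi / 6)) * of_real (t\<^sup>2) = cis (pi / 6) + of_real (sqrt 3 * t\<^sup>2)"
    by (simp only: of_real_mult)
  then have "(1 + \<kappa> * of_real (t\<^sup>2)) * cis (pi / 6) = cis (pi / 6) + of_real (sqrt 3 * t\<^sup>2)"
    by (subst distrib_right) (simp only: mult_1_left mult_ac)
  then have "of_real (r\<^sup>2) * cis (2 * \<theta> + pi / 6) = cis (pi / 6) + of_real (sqrt 3 * t\<^sup>2)"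
    unfolding sq[symmetric] by (simp add: mult.assoc cis_mult)
  then have "r\<^sup>2 * sin (2 * \<theta> + pi / 6) = 1 / 2"
    by (simp add: complex_eq_iff sin_30)
  then have "0 < r\<^sup>2 * sin (2 * \<theta> + pi / 6)"
    by simp
  then have pos: "0 < sin (2 * \<theta> + pi / 6)"
    using r by (simp add: zero_less_mult_iff)
  have gt: "- (pi / 12) < \<theta>"
  proof (rule ccontr)
    assume "\<not> ?thesis"
    then have "0 \<le> sin (- (2 * \<theta> + pi / 6))"
      using half by (intro sin_ge_zero) auto
    with pos show False
      unfolding sin_minus by linarith
  qed
  have "sin (branch \<phi>) = of_real (sin \<phi> * r) * cis (pi / 3 + \<theta>)"
    using \<phi> by (simp add: sin_branch polar cis_mult mult.assoc)
  moreover have "0 < sin \<phi> * r"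
    using \<phi> r by (simp add: sin_gt_zero)
  ultimately show "\<exists>B \<psi>. B > 0 \<and> pi / 4 < \<psi> \<and> \<psi> < pi / 3 \<and>
      sin (branch \<phi>) = complex_of_real B * cis \<psi>"
    using gt neg by (intro exI[of _ "sin \<phi> * r"] exI[of _ "pi / 3 + \<theta>"]) auto
qed

text \<open>The cosines of two regular branches agree by definition; the sines then agree up to
  sign, and the sign is fixed since both have positive real part.  So the branches differ by a
  multiple of 2 pi, which is constant by continuity and vanishes at 0.  At pi nothing is prescribed
  about the sine, hence the half-open interval.\<close>

lemma regular_branch_unique:
  assumes "regular_branch \<beta>" "regular_branch \<gamma>" "0 \<le> \<phi>" "\<phi> < pi"
  shows "\<beta> \<phi> = \<gamma> \<phi>"
proof -
  have sin_pos: "0 < Re (sin (\<beta> x))" if reg: "regular_branch \<beta>" and x: "0 < x" "x < pi" for \<beta> x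
  proof -
    obtain B \<psi> where *: "B > 0" "pi / 4 < \<psi>" "\<psi> < pi / 3" "sin (\<beta> x) = of_real B * cis \<psi>"
      using reg x unfolding regular_branch_def by (meson greaterThanLessThan_iff)
    have "0 < cos \<psi>"
      using * pi_gt_zero by (intro cos_gt_zero_pi; linarith)
    then show ?thesis
      using * by simp
  qed
  have cos_eq: "cos (\<beta> x) = cos (\<gamma> x)" if "0 \<le> x" "x < pi" for x
    using assms that unfolding regular_branch_def by auto
  have sin_eq: "sin (\<beta> x) = sin (\<gamma> x)" if "0 \<le> x" "x < pi" for x
  proof (cases "x = 0")
    case True
    then show ?thesis
      using assms unfolding regular_branch_def by auto
  next
    case False
    have "(sin (\<beta> x))\<^sup>2 = (sin (\<gamma> x))\<^sup>2"
      using cos_eq[OF that] by (simp add: sin_squared_eq)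
    moreover have "sin (\<beta> x) \<noteq> - sin (\<gamma> x)"
      using sin_pos[OF assms(1), of x] sin_pos[OF assms(2), of x] False that
      by (metis less_le_not_le less_eq_real_def minus_complex.sel(1) neg_0_less_iff_less
          not_less_iff_gr_or_eq uminus_complex.sel(1))
    ultimately show ?thesis
      by (metis power2_eq_iff)
  qed
  define \<delta> where "\<delta> x = \<beta> x - \<gamma> x" for x
  have period: "\<exists>k::int. \<delta> x = of_real (2 * of_int k * pi)" if "x \<in> {0..<pi}" for x
  proof -
    have "cos (\<delta> x) = 1"
      using that cos_eq[of x] sin_eq[of x]
      by (simp add: \<delta>_def cos_diff flip: power2_eq_square)
    then show ?thesis
      by (simp add: cos_eq_1 mult_ac)
  qed
  have "\<delta> constant_on {0..<pi}"
  proof (rule continuous_discrete_range_constant)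
    show "continuous_on {0..<pi} \<delta>"
      unfolding \<delta>_def using assms unfolding regular_branch_def
      by (intro continuous_on_diff) (auto intro: continuous_on_subset)
  next
    fix x assume x: "x \<in> {0..<pi}"
    then obtain k :: int where k: "\<delta> x = of_real (2 * of_int k * pi)"
      using period by blast
    have "2 * pi \<le> norm (\<delta> y - \<delta> x)" if "y \<in> {0..<pi}" "\<delta> y \<noteq> \<delta> x" for y
    proof -
      obtain l :: int where l: "\<delta> y = of_real (2 * of_int l * pi)"
        using period \<open>y \<in> {0..<pi}\<close> by blast
      have "\<delta> y - \<delta> x = of_real (2 * pi * of_int (l - k))"
        using k l by (simp add: algebra_simps)
      then have "norm (\<delta> y - \<delta> x) = 2 * pi * \<bar>of_int (l - k)\<bar>"
        by (simp only: norm_of_real) (simp add: abs_mult)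
      moreover have "l \<noteq> k"
        using k l \<open>\<delta> y \<noteq> \<delta> x\<close> by auto
      then have "1 \<le> \<bar>real_of_int (l - k)\<bar>"
        by linarith
      ultimately show ?thesis
        by simp
    qed
    then show "\<exists>e>0. \<forall>y. y \<in> {0..<pi} \<and> \<delta> y \<noteq> \<delta> x \<longrightarrow> e \<le> norm (\<delta> y - \<delta> x)"
      by (intro exI[of _ "2 * pi"]) auto
  qed simp
  then have "\<delta> \<phi> = \<delta> 0"
    using assms(3,4) unfolding constant_on_def by fastforce
  also have "\<delta> 0 = 0"
    using assms unfolding \<delta>_def regular_branch_def by simp
  finally show ?thesis
    by (simp add: \<delta>_def)
qed

lemma beta_eq_branch: "beta \<phi> = branch \<phi>" if "0 \<le> \<phi>" "\<phi> < pi"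
proof (rule regular_branch_unique[OF _ regular_branch_branch that])
  show "regular_branch beta"
    unfolding beta_def by (rule someI[where P = regular_branch]) (rule regular_branch_branch)
qed

section \<open>Taylor bounds for the branch\<close>

text \<open>The constants are not optimal; what matters is tan(\<phi>/2)^2 = \<phi>^2/4 + O(\<phi>^4).\<close>

lemma tan_half_sq_bounds:
  fixes \<phi> :: real
  assumes "0 \<le> \<phi>" "\<phi> \<le> 1"
  shows "0 \<le> tan (\<phi> / 2)"
    and "(tan (\<phi> / 2))\<^sup>2 \<le> \<phi>\<^sup>2 / 3"
    and "\<phi>\<^sup>2 / 4 \<le> (tan (\<phi> / 2))\<^sup>2"
    and "(tan (\<phi> / 2))\<^sup>2 \<le> \<phi>\<^sup>2 / 4 + \<phi> ^ 4"
proof -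
  let ?x = "\<phi> / 2"
  have pi: "1 < pi / 2"
    using pi_gt3 by simp
  have k: "0 < cos y" if "0 \<le> y" "y \<le> ?x" for y
    using that assms pi by (intro cos_gt_zero_pi) linarith+
  have "tan 0 - 0 \<le> tan ?x - ?x"
  proof (rule DERIV_nonneg_imp_nondecreasing[of 0 ?x "\<lambda>x. tan x - x"])
    fix y assume y: "0 \<le> y" "y \<le> ?x"
    have "1 \<le> inverse ((cos y)\<^sup>2)"
      using k[OF y] cos_le_one[of y] by (intro one_le_inverse) (auto intro: power_le_one)
    moreover have "((\<lambda>x. tan x - x) has_real_derivative inverse ((cos y)\<^sup>2) - 1) (at y)"
      using k[OF y] by (intro derivative_intros) auto
    ultimately show "\<exists>d. ((\<lambda>x. tan x - x) has_real_derivative d) (at y) \<and> 0 \<le> d"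
      by auto
  qed (use assms in simp)
  then have le_tan: "?x \<le> tan ?x"
    by simp
  with assms show "0 \<le> tan ?x"
    by linarith
  show "\<phi>\<^sup>2 / 4 \<le> (tan ?x)\<^sup>2"
    using power_mono[OF le_tan, of 2] assms by (simp add: power_divide)
  have "0 \<le> sin ?x"
    using assms pi by (intro sin_ge_zero) linarith+
  then have s: "(sin ?x)\<^sup>2 \<le> \<phi>\<^sup>2 / 4"
    using power_mono[OF sin_x_le_x[of ?x], of 2] assms by (simp add: power_divide)
  have sq: "\<phi>\<^sup>2 \<le> 1"
    using assms by (intro power_le_one)
  have k2: "(cos ?x)\<^sup>2 \<ge> 1 - \<phi>\<^sup>2 / 4"
    using s by (simp add: cos_squared_eq)
  have "(tan ?x)\<^sup>2 = (sin ?x)\<^sup>2 / (cos ?x)\<^sup>2"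
    by (simp add: tan_def power_divide)
  also have "\<dots> \<le> (\<phi>\<^sup>2 / 4) / (1 - \<phi>\<^sup>2 / 4)"
    using s k2 sq by (intro frac_le) auto
  finally have up: "(tan ?x)\<^sup>2 \<le> (\<phi>\<^sup>2 / 4) / (1 - \<phi>\<^sup>2 / 4)" .
  also have "\<dots> \<le> (\<phi>\<^sup>2 / 4) / (3 / 4)"
    using sq by (intro divide_left_mono) auto
  finally show "(tan ?x)\<^sup>2 \<le> \<phi>\<^sup>2 / 3"
    by simp
  have "(\<phi>\<^sup>2 / 4) / (1 - \<phi>\<^sup>2 / 4) \<le> \<phi>\<^sup>2 / 4 + \<phi> ^ 4"
  proof -
    have "0 \<le> \<phi>\<^sup>2 * \<phi>\<^sup>2 * (15 / 16 - \<phi>\<^sup>2 / 4)"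
      using sq by simp
    then have "\<phi>\<^sup>2 / 4 \<le> (\<phi>\<^sup>2 / 4 + \<phi> ^ 4) * (1 - \<phi>\<^sup>2 / 4)"
      by (simp add: algebra_simps power2_eq_square power4_eq_xxxx)
    then show ?thesis
      using sq by (subst pos_divide_le_eq) auto
  qed
  with up show "(tan ?x)\<^sup>2 \<le> \<phi>\<^sup>2 / 4 + \<phi> ^ 4"
    by linarith
qed

text \<open>Factor G^2 - 1 = (G - 1)(G + 1) for the ratio G; the second factor has norm at least 1
  because Re G > 0.\<close>

lemma norm_ratio_minus_1_le_tan: "norm (ratio \<phi> - 1) \<le> 2 * (tan (\<phi> / 2))\<^sup>2"
proof -
  have "(ratio \<phi> - 1) * (ratio \<phi> + 1) = \<kappa> * of_real ((tan (\<phi> / 2))\<^sup>2)"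
    using ratio_sq[of \<phi>] by (simp add: algebra_simps power2_eq_square)
  then have "norm (ratio \<phi> - 1) * norm (ratio \<phi> + 1) = norm \<kappa> * (tan (\<phi> / 2))\<^sup>2"
    by (metis norm_mult norm_of_real abs_of_nonneg zero_le_power2)
  also have "\<dots> \<le> 2 * (tan (\<phi> / 2))\<^sup>2"
    using norm_kappa_le by (intro mult_right_mono) auto
  finally have le: "norm (ratio \<phi> - 1) * norm (ratio \<phi> + 1) \<le> 2 * (tan (\<phi> / 2))\<^sup>2" .
  have "1 \<le> Re (ratio \<phi> + 1)"
    using Re_ratio_pos[of \<phi>] by simp
  also have "\<dots> \<le> norm (ratio \<phi> + 1)"
    by (rule complex_Re_le_cmod)
  finally have "norm (ratio \<phi> - 1) * 1 \<le> norm (ratio \<phi> - 1) * norm (ratio \<phi> + 1)"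
    by (intro mult_left_mono) auto
  with le show ?thesis
    by simp
qed

lemma norm_ratio_minus_1_le:
  assumes "0 \<le> \<phi>" "\<phi> \<le> 1"
  shows "norm (ratio \<phi> - 1) \<le> \<phi>\<^sup>2"
proof -
  have "norm (ratio \<phi> - 1) \<le> 2 * (tan (\<phi> / 2))\<^sup>2"
    by (rule norm_ratio_minus_1_le_tan)
  also have "\<dots> \<le> 2 * (\<phi>\<^sup>2 / 3)"
    using tan_half_sq_bounds(2)[OF assms] by simp
  also have "\<dots> \<le> \<phi>\<^sup>2"
    by simp
  finally show ?thesis .
qed

text \<open>From G^2 - 1 = \<kappa> T with T = tan(\<phi>/2)^2 one gets the exact identity
  G - 1 - \<kappa> T/2 = - (G - 1)^2/2, which is of fourth order; it remains to replace T by \<phi>^2/4.\<close>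

lemma norm_ratio_second_order:
  assumes "0 \<le> \<phi>" "\<phi> \<le> 1"
  shows "norm (ratio \<phi> - 1 - \<kappa> * of_real (\<phi>\<^sup>2 / 8)) \<le> 2 * \<phi> ^ 4"
proof -
  define T where "T = (tan (\<phi> / 2))\<^sup>2"
  note T = tan_half_sq_bounds[OF assms, folded T_def]
  have "ratio \<phi> - 1 - \<kappa> * of_real (\<phi>\<^sup>2 / 8)
      = - ((ratio \<phi> - 1)\<^sup>2 / 2) + \<kappa> * of_real ((T - \<phi>\<^sup>2 / 4) / 2)"
  proof -
    have "\<kappa> * of_real ((T - \<phi>\<^sup>2 / 4) / 2) = ((ratio \<phi>)\<^sup>2 - 1) / 2 - \<kappa> * of_real (\<phi>\<^sup>2 / 8)"
      unfolding ratio_sq[of \<phi>, folded T_def] by (simp add: algebra_simps add_divide_distrib diff_divide_distrib)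
    then show ?thesis
      by (simp add: power2_eq_square field_simps)
  qed
  also have "norm \<dots> \<le> norm (- ((ratio \<phi> - 1)\<^sup>2 / 2)) + norm (\<kappa> * of_real ((T - \<phi>\<^sup>2 / 4) / 2))"
    by (rule norm_triangle_ineq)
  also have "\<dots> = (norm (ratio \<phi> - 1))\<^sup>2 / 2 + norm \<kappa> * ((T - \<phi>\<^sup>2 / 4) / 2)"
    using T by (simp only: norm_mult norm_minus_cancel norm_divide norm_power norm_of_real)
      (simp add: norm_numeral)
  also have "\<dots> \<le> (\<phi>\<^sup>2)\<^sup>2 / 2 + 2 * (\<phi> ^ 4 / 2)"
    using T norm_ratio_minus_1_le[OF assms] norm_kappa_le
    by (intro add_mono divide_right_mono power_mono mult_mono) auto
  also have "\<dots> \<le> 2 * \<phi> ^ 4"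
    by (simp flip: power_mult)
  finally show ?thesis .
qed

lemma norm_ratio_deriv_le:
  assumes "0 \<le> \<phi>" "\<phi> \<le> 1"
  shows "norm (\<kappa> * of_real (tan (\<phi> / 2) * (1 + (tan (\<phi> / 2))\<^sup>2) / 2) / ratio \<phi>) \<le> 2"
proof -
  define t where "t = tan (\<phi> / 2)"
  note t = tan_half_sq_bounds[OF assms, folded t_def]
  have "\<phi>\<^sup>2 \<le> 1"
    using assms by (intro power_le_one)
  then have t2: "t\<^sup>2 \<le> 1"
    using t by linarith
  then have t1: "t \<le> 1"
    by (simp add: power_le_one_iff t)
  have "norm (\<kappa> * of_real (t * (1 + t\<^sup>2) / 2) / ratio \<phi>)
      = norm \<kappa> * (t * (1 + t\<^sup>2) / 2) / norm (ratio \<phi>)"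
    using t(1) by (simp only: norm_mult norm_divide norm_of_real) simp
  also have "\<dots> \<le> 2 * (1 * (1 + 1) / 2) / 1"
    using t t1 t2 norm_kappa_le norm_ratio_ge[of \<phi>]
    by (intro frac_le mult_mono divide_right_mono add_mono) auto
  finally show ?thesis
    by (simp add: t_def)
qed

text \<open>The derivative \<omega>/G differs from \<omega> by O(\<phi>^2); integrate.\<close>

lemma norm_branch_minus_le:
  assumes "0 \<le> \<phi>" "\<phi> \<le> 1"
  shows "norm (branch \<phi> - \<omega> * of_real \<phi>) \<le> \<phi> ^ 3"
proof -
  have "norm ((branch \<phi> - \<omega> * of_real \<phi>) - (branch 0 - \<omega> * of_real 0)) \<le> \<phi>\<^sup>2 * norm (\<phi> - 0)"
  proof (rule differentiable_bound[where S = "{0..\<phi>}" and f = "\<lambda>x. branch x - \<omega> * of_real x"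
        and f' = "\<lambda>x h. h *\<^sub>R (\<omega> / ratio x - \<omega>)"])
    fix x assume x: "x \<in> {0..\<phi>}"
    then have x1: "0 \<le> x" "x \<le> 1" "x < pi" "x \<le> \<phi>"
      using assms pi_gt3 by auto
    have "((\<lambda>x. branch x - \<omega> * of_real x) has_vector_derivative \<omega> / ratio x - \<omega>) (at x)"
      by (rule derivative_eq_intros branch_has_vector_derivative x1 refl | simp)+
    then show "((\<lambda>x. branch x - \<omega> * of_real x) has_derivative (\<lambda>h. h *\<^sub>R (\<omega> / ratio x - \<omega>)))
         (at x within {0..\<phi>})"
      unfolding has_vector_derivative_def by (rule has_derivative_at_withinI)
    have "\<omega> / ratio x - \<omega> = \<omega> * (1 - ratio x) / ratio x"
      using ratio_nonzero[of x] by (simp add: field_simps)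
    then have "norm (\<omega> / ratio x - \<omega>) = norm (ratio x - 1) / norm (ratio x)"
      by (simp add: norm_divide norm_mult norm_minus_commute)
    also have "\<dots> \<le> norm (ratio x - 1) / 1"
      using norm_ratio_ge[of x] by (intro divide_left_mono) auto
    also have "\<dots> \<le> x\<^sup>2"
      using norm_ratio_minus_1_le x1 by simp
    also have "\<dots> \<le> \<phi>\<^sup>2"
      using x1 by (intro power_mono)
    finally have le: "norm (\<omega> / ratio x - \<omega>) \<le> \<phi>\<^sup>2" .
    show "onorm (\<lambda>h. h *\<^sub>R (\<omega> / ratio x - \<omega>)) \<le> \<phi>\<^sup>2"
    proof (rule onorm_le)
      show "norm (h *\<^sub>R (\<omega> / ratio x - \<omega>)) \<le> \<phi>\<^sup>2 * norm h" for h
        using mult_left_mono[OF le, of "\<bar>h\<bar>"] by (simp add: mult.commute)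
    qed
  qed (use assms in auto)
  then show ?thesis
    using assms by (simp add: branch_def power2_eq_square power3_eq_cube)
qed

section \<open>Contractions and exponential bounds\<close>

lemma abs_arctan_diff_le: "\<bar>arctan x - arctan y\<bar> \<le> \<bar>x - y\<bar>"
proof -
  have "norm (arctan x - arctan y) \<le> 1 * norm (x - y)"
    by (rule field_differentiable_bound[where S = UNIV and f' = "\<lambda>z. inverse (1 + z\<^sup>2)"])
      (auto intro: DERIV_arctan inverse_le_1_iff[THEN iffD2] simp: add_pos_nonneg)
  then show ?thesis
    by simp
qed

text \<open>The arc tangent is 1-Lipschitz and has range in (-pi/2, pi/2), so composing it with a
  contraction gives a self-map to which Banach's theorem applies.\<close>

lemma arctan_fixed_point_unique:
  fixes g :: "real \<Rightarrow> real"
  assumes lip: "\<And>x y. \<bar>x\<bar> \<le> pi / 2 \<Longrightarrow> \<bar>y\<bar> \<le> pi / 2 \<Longrightarrow> \<bar>g x - g y\<bar> \<le> L * \<bar>x - y\<bar>"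
    and L: "0 \<le> L" "L < 1"
  shows "\<exists>!u. - (pi / 2) < u \<and> u < pi / 2 \<and> u = arctan (g u)"
proof -
  have "\<exists>!u\<in>{- (pi / 2)..pi / 2}. arctan (g u) = u"
  proof (rule Banach_fix[OF _ _ L])
    show "(\<lambda>u. arctan (g u)) ` {- (pi / 2)..pi / 2} \<subseteq> {- (pi / 2)..pi / 2}"
      by (intro image_subsetI)
        (simp only: atLeastAtMost_iff less_imp_le[OF arctan_lbound] less_imp_le[OF arctan_ubound])
  next
    fix x y :: real assume "x \<in> {- (pi / 2)..pi / 2}" "y \<in> {- (pi / 2)..pi / 2}"
    then have "\<bar>x\<bar> \<le> pi / 2" "\<bar>y\<bar> \<le> pi / 2"
      by auto
    then show "dist (arctan (g x)) (arctan (g y)) \<le> L * dist x y"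
      unfolding dist_real_def
      by (intro order_trans[OF abs_arctan_diff_le] lip)
  qed (auto simp: compact_imp_complete)
  moreover have "- (pi / 2) < u \<and> u < pi / 2" if "u = arctan (g u)" for u
    using that arctan_bounded by metis
  ultimately show ?thesis
    by (metis atLeastAtMost_iff less_imp_le)
qed

text \<open>Only the two right-hand sides at the fixed point of the second one have to be compared.
  This is essential here: the right-hand sides are within O(1/q^2) of each other at that point, but
  not on the whole interval.\<close>

lemma arctan_fixed_points_close:
  fixes g h :: "real \<Rightarrow> real"
  assumes lip: "\<And>x y. \<bar>x\<bar> \<le> pi / 2 \<Longrightarrow> \<bar>y\<bar> \<le> pi / 2 \<Longrightarrow> \<bar>g x - g y\<bar> \<le> L * \<bar>x - y\<bar>"
    and u: "u = arctan (g u)" and v: "v = arctan (h v)"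
    and close: "\<bar>g v - h v\<bar> \<le> e"
  shows "(1 - L) * \<bar>u - v\<bar> \<le> e"
proof -
  have "\<bar>u\<bar> \<le> pi / 2" "\<bar>v\<bar> \<le> pi / 2"
    using arctan_bounded[of "g u"] arctan_bounded[of "h v"] u v by auto
  then have "\<bar>g u - g v\<bar> \<le> L * \<bar>u - v\<bar>"
    by (rule lip)
  moreover have "\<bar>u - v\<bar> \<le> \<bar>g u - h v\<bar>"
    using abs_arctan_diff_le[of "g u" "h v"] u v by simp
  ultimately have "\<bar>u - v\<bar> \<le> L * \<bar>u - v\<bar> + e"
    using close by linarith
  then show ?thesis
    by (simp add: algebra_simps)
qed

lemma norm_exp_minus_1_le: "norm (exp z - 1) \<le> 3 * norm z" if "norm z \<le> 1" for z :: complex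
proof -
  have "norm (exp z - exp 0) \<le> 3 * norm (z - 0)"
  proof (rule field_differentiable_bound[where S = "cball 0 1" and f' = exp])
    fix w :: complex assume "w \<in> cball 0 1"
    then have "norm w \<le> 1"
      by simp
    then have "norm (exp w) \<le> exp 1"
      using norm_exp[of w] by (meson exp_le_cancel_iff order_trans)
    then show "norm (exp w) \<le> 3"
      using exp_le by linarith
  qed (use that in \<open>auto intro: DERIV_exp DERIV_subset\<close>)
  then show ?thesis
    by simp
qed

lemma power_exp_minus_le: "x ^ k * exp (- x) \<le> fact k" if "0 \<le> x" for x :: real
proof -
  have "(\<Sum>n\<in>{k}. x ^ n /\<^sub>R fact n) \<le> (\<Sum>n. x ^ n /\<^sub>R fact n)"
    using that summable_exp_generic[of x] by (intro sum_le_suminf) auto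
  then have "x ^ k / fact k \<le> exp x"
    by (simp add: exp_def divide_inverse mult.commute)
  then show ?thesis
    by (simp add: exp_minus field_simps)
qed

section \<open>The complex tangent in exponential form\<close>

definition moebius :: "complex \<Rightarrow> complex" where
  "moebius z = z / (1 + z)"

text \<open>For \<sigma> = 1 this is 2 Re (G tan (\<zeta>/2)) and for \<sigma> = -1 it is -2 Re (G cot (\<zeta>/2)).  The
  exponential form isolates the part 2 Re (iG) = -2 Im G, which does not decay, from a rest of the
  size of exp (- Im \<zeta>).\<close>

definition tan_like :: "real \<Rightarrow> complex \<Rightarrow> complex \<Rightarrow> real" where
  "tan_like \<sigma> G \<zeta> = 4 * Im (G * moebius (of_real \<sigma> * exp (\<i> * \<zeta>))) - 2 * Im G"

text \<open>With w = \<sigma> exp (i \<zeta>) and e = |w|, the denominator cosh (Im \<zeta>) + \<sigma> cos (Re \<zeta>) equals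
  |1 + w|^2 / (2e).\<close>

lemma tan_like_eq:
  assumes \<sigma>: "\<sigma>\<^sup>2 = 1" and pos: "0 < Im \<zeta>"
  shows "tan_like \<sigma> G \<zeta> =
    2 * ((\<sigma> * Re G * sin (Re \<zeta>) - Im G * sinh (Im \<zeta>)) / (cosh (Im \<zeta>) + \<sigma> * cos (Re \<zeta>)))"
proof -
  define e where "e = exp (- Im \<zeta>)"
  define s where "s = \<sigma> * sin (Re \<zeta>)"
  define c where "c = \<sigma> * cos (Re \<zeta>)"
  define w where "w = of_real \<sigma> * exp (\<i> * \<zeta>)"
  have e: "0 < e" "e < 1"
    using pos by (simp_all add: e_def)
  have sc: "s\<^sup>2 + c\<^sup>2 = 1"
    using \<sigma> by (simp add: s_def c_def power_mult_distrib)
  have w: "w = Complex (e * c) (e * s)"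
    by (simp add: w_def complex_eq_iff Re_exp Im_exp e_def s_def c_def)
  define N where "N = (1 + e * c)\<^sup>2 + (e * s)\<^sup>2"
  have N_eq: "N = 1 + 2 * (e * c) + e\<^sup>2"
  proof -
    have "N = 1 + 2 * (e * c) + e\<^sup>2 * (s\<^sup>2 + c\<^sup>2)"
      unfolding N_def by (simp add: power2_eq_square algebra_simps)
    then show ?thesis
      by (simp add: sc)
  qed
  have "\<bar>c\<bar> \<le> 1"
    using sc by (metis abs_le_square_iff abs_one le_add_same_cancel2 one_power2 zero_le_power2)
  then have "\<bar>e * c\<bar> \<le> e * 1"
    using e by (simp add: abs_mult)
  then have "0 < (1 + e * c)\<^sup>2"
    using e by (simp add: abs_le_iff)
  then have N: "0 < N"
    unfolding N_def by (simp add: add_pos_nonneg)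
  have moebius: "moebius w = Complex ((e * c + e\<^sup>2) / N) (e * s / N)"
  proof -
    have s2: "s * s = 1 - c * c"
      using sc by (simp add: power2_eq_square)
    have es: "e * s * (e * s) = e * e * (1 - c * c)"
      unfolding s2[symmetric] by simp
    have "(e * c + e\<^sup>2) * (1 + e * c) - e * s * (e * s) = e * c * N"
      unfolding N_eq es by (simp add: power2_eq_square algebra_simps)
    moreover have "(e * c + e\<^sup>2) * (e * s) + e * s * (1 + e * c) = e * s * N"
      unfolding N_eq by (simp add: power2_eq_square algebra_simps)
    ultimately have "Complex ((e * c + e\<^sup>2) / N) (e * s / N) * (1 + w) = w"
      using N unfolding w
      by (simp add: complex_eq_iff add_divide_distrib[symmetric] diff_divide_distrib[symmetric])
    moreover have "1 + w \<noteq> 0"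
      using N unfolding w N_def by (auto simp: complex_eq_iff)
    ultimately show ?thesis
      by (simp add: moebius_def field_simps)
  qed
  have h: "cosh (Im \<zeta>) + c = N / (2 * e)" "sinh (Im \<zeta>) = (1 - e\<^sup>2) / (2 * e)"
    using e unfolding N_eq by (simp_all add: cosh_def sinh_def e_def exp_minus power2_eq_square field_simps)
  have "tan_like \<sigma> G \<zeta> = (4 * (Re G * (e * s)) - 2 * Im G * (1 - e\<^sup>2)) / N"
    unfolding tan_like_def w_def[symmetric] moebius using N by (simp add: field_simps) (simp add: N_eq algebra_simps)
  also have "\<dots> = 2 * ((Re G * s - Im G * ((1 - e\<^sup>2) / (2 * e))) / (N / (2 * e)))"
    using N e by (simp add: field_simps)
  finally show ?thesis
    unfolding h[symmetric] by (simp add: s_def c_def mult_ac)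
qed

text \<open>The bound 1/12 is what makes the derivative of the right-hand side smaller than 1; it
  rests on exp (5/2) \<ge> 12.\<close>

lemma exp_i_times_bound:
  assumes "\<bar>\<sigma>\<bar> = 1" "5 / 2 \<le> Im \<zeta>"
  shows "norm (of_real \<sigma> * exp (\<i> * \<zeta>)) \<le> 1 / 12"
proof -
  (* The quadratic Taylor bound at 5/2 itself is too weak; it suffices for the 20th part of 5/2. *)
  have "(12::real) \<le> (1 + 1 / 8 + (1 / 8)\<^sup>2 / 2) ^ 20"
    by (simp add: power_divide field_simps)
  also have "\<dots> \<le> exp (1 / 8) ^ 20"
    by (intro power_mono exp_lower_Taylor_quadratic) auto
  also have "\<dots> = exp (5 / 2)"
    by (simp flip: exp_of_nat_mult)
  also have "\<dots> \<le> exp (Im \<zeta>)"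
    using assms by simp
  finally have "inverse (exp (Im \<zeta>)) \<le> inverse 12"
    by (intro le_imp_inverse_le) auto
  then show ?thesis
    using assms by (simp add: norm_mult exp_minus)
qed

lemma norm_one_plus_ge: "11 / 12 \<le> norm (1 + z)" if "norm z \<le> 1 / 12" for z :: complex
  using that norm_triangle_ineq2[of 1 "- z"] by simp

lemma norm_moebius_le: "norm (moebius z) \<le> 12 / 11 * norm z" if "norm z \<le> 1 / 12"
proof -
  have "norm z / norm (1 + z) \<le> norm z / (11 / 12)"
    using norm_one_plus_ge[OF that] by (intro divide_left_mono) auto
  then show ?thesis
    by (simp add: moebius_def norm_divide)
qed

lemma norm_moebius_diff_le:
  assumes "norm z \<le> 1 / 12" "norm w \<le> 1 / 12"
  shows "norm (moebius z - moebius w) \<le> 144 / 121 * norm (z - w)"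
proof -
  note nz = norm_one_plus_ge[OF assms(1)] and nw = norm_one_plus_ge[OF assms(2)]
  have "1 + z \<noteq> 0" "1 + w \<noteq> 0"
    using nz nw by auto
  then have "moebius z - moebius w = (z - w) / ((1 + z) * (1 + w))"
    by (simp add: moebius_def field_simps)
  then have "norm (moebius z - moebius w) = norm (z - w) / (norm (1 + z) * norm (1 + w))"
    by (simp add: norm_divide norm_mult)
  also have "\<dots> \<le> norm (z - w) / (11 / 12 * (11 / 12))"
    using nz nw by (intro divide_left_mono mult_mono mult_pos_pos) auto
  finally show ?thesis
    by simp
qed

text \<open>The derivative of z / (1 + z) along z = w is w' / (1 + w)^2, and w' = i \<zeta>' w.  With
  |w| \<le> 1/12 one has 4 |w| / |1 + w|^2 \<le> 48/121.  The product G \<zeta>' is kept together since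
  in the application it does not depend on G.\<close>

lemma tan_like_has_derivative:
  fixes G \<zeta> :: "real \<Rightarrow> complex"
  assumes \<sigma>: "\<bar>\<sigma>\<bar> = 1" and im: "5 / 2 \<le> Im (\<zeta> u)"
    and G: "(G has_vector_derivative G') (at u)"
    and \<zeta>: "(\<zeta> has_vector_derivative \<zeta>') (at u)"
  obtains D where "((\<lambda>u. tan_like \<sigma> (G u) (\<zeta> u)) has_real_derivative D) (at u)"
    and "\<bar>D\<bar> \<le> 3 * norm G' + 48 / 121 * norm (G u * \<zeta>')"
proof -
  define w where "w = of_real \<sigma> * exp (\<i> * \<zeta> u)"
  have w: "norm w \<le> 1 / 12"
    unfolding w_def using \<sigma> im by (rule exp_i_times_bound)
  note w1 = norm_one_plus_ge[OF w]
  then have w0: "1 + w \<noteq> 0"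
    by auto
  have "((\<lambda>z. moebius (of_real \<sigma> * exp (\<i> * z))) has_field_derivative \<i> * w / (1 + w)\<^sup>2) (at (\<zeta> u))"
    unfolding moebius_def using w0 unfolding w_def
    by (auto intro!: derivative_eq_intros simp: field_simps power2_eq_square)
  from field_vector_diff_chain_at[OF \<zeta> this]
  have "((\<lambda>x. moebius (of_real \<sigma> * exp (\<i> * \<zeta> x))) has_vector_derivative \<zeta>' * (\<i> * w / (1 + w)\<^sup>2)) (at u)"
    by (simp add: o_def)
  from has_vector_derivative_mult[OF G this]
  have "((\<lambda>x. G x * moebius (of_real \<sigma> * exp (\<i> * \<zeta> x))) has_vector_derivative
      G u * (\<zeta>' * (\<i> * w / (1 + w)\<^sup>2)) + G' * moebius w) (at u)"
    by (simp add: w_def)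
  then have 1: "((\<lambda>x. Im (G x * moebius (of_real \<sigma> * exp (\<i> * \<zeta> x)))) has_vector_derivative
      Im (G u * (\<zeta>' * (\<i> * w / (1 + w)\<^sup>2)) + G' * moebius w)) (at u)"
    by (rule bounded_linear.has_vector_derivative[OF bounded_linear_Im])
  have 2: "((\<lambda>x. Im (G x)) has_vector_derivative Im G') (at u)"
    using G by (rule bounded_linear.has_vector_derivative[OF bounded_linear_Im])
  define D where "D = 4 * Im (G u * (\<zeta>' * (\<i> * w / (1 + w)\<^sup>2)) + G' * moebius w) - 2 * Im G'"
  have "((\<lambda>u. tan_like \<sigma> (G u) (\<zeta> u)) has_real_derivative D) (at u)"
    unfolding tan_like_def D_def
    using 1 2 unfolding has_real_derivative_iff_has_vector_derivative[symmetric]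
    by (intro DERIV_diff DERIV_cmult)
  moreover have "\<bar>D\<bar> \<le> 3 * norm G' + 48 / 121 * norm (G u * \<zeta>')"
  proof -
    have a: "norm (\<i> * w / (1 + w)\<^sup>2) \<le> (1 / 12) / (11 / 12)\<^sup>2"
      unfolding norm_divide norm_mult norm_power norm_ii mult_1_left using w w1
      by (intro frac_le power_mono) auto
    have "norm (G u * (\<zeta>' * (\<i> * w / (1 + w)\<^sup>2))) = norm (G u * \<zeta>') * norm (\<i> * w / (1 + w)\<^sup>2)"
      by (metis mult.assoc norm_mult)
    also have "\<dots> \<le> norm (G u * \<zeta>') * ((1 / 12) / (11 / 12)\<^sup>2)"
      using a by (intro mult_left_mono) auto
    finally have b: "norm (G u * (\<zeta>' * (\<i> * w / (1 + w)\<^sup>2))) \<le> norm (G u * \<zeta>') * (12 / 121)"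
      by (simp add: power2_eq_square)
    have "norm (moebius w) \<le> 1 / 11"
      using norm_moebius_le[OF w] w by linarith
    then have c: "norm (G' * moebius w) \<le> norm G' * (1 / 11)"
      unfolding norm_mult by (intro mult_left_mono) auto
    have "\<bar>Im (G u * (\<zeta>' * (\<i> * w / (1 + w)\<^sup>2)) + G' * moebius w)\<bar>
        \<le> norm (G u * (\<zeta>' * (\<i> * w / (1 + w)\<^sup>2))) + norm (G' * moebius w)"
      by (rule order_trans[OF abs_Im_le_cmod norm_triangle_ineq])
    then have "\<bar>Im (G u * (\<zeta>' * (\<i> * w / (1 + w)\<^sup>2)) + G' * moebius w)\<bar>
        \<le> norm (G u * \<zeta>') * (12 / 121) + norm G' * (1 / 11)"
      using b c by linarith
    then show ?thesis
      unfolding D_def using abs_Im_le_cmod[of G'] norm_ge_zero[of G'] by linarith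
  qed
  ultimately show ?thesis
    by (rule that)
qed

lemma abs_tan_like_le:
  assumes "\<bar>\<sigma>\<bar> = 1" "5 / 2 \<le> Im \<zeta>"
  shows "\<bar>tan_like \<sigma> G \<zeta>\<bar> \<le> 5 * (norm G * exp (- Im \<zeta>)) + 2 * \<bar>Im G\<bar>"
proof -
  define w where "w = of_real \<sigma> * exp (\<i> * \<zeta>)"
  have w: "norm w \<le> 1 / 12"
    unfolding w_def using assms by (rule exp_i_times_bound)
  have nw: "norm w = exp (- Im \<zeta>)"
    using assms by (simp add: w_def norm_mult)
  have "\<bar>Im (G * moebius w)\<bar> \<le> norm G * norm (moebius w)"
    using abs_Im_le_cmod[of "G * moebius w"] by (simp add: norm_mult)
  also have "\<dots> \<le> norm G * (12 / 11 * exp (- Im \<zeta>))"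
    using norm_moebius_le[OF w] nw by (intro mult_left_mono) auto
  finally show ?thesis
    unfolding tan_like_def w_def[symmetric]
    using mult_nonneg_nonneg[OF norm_ge_zero[of G] exp_ge_zero[of "- Im \<zeta>"]] by linarith
qed

text \<open>The perturbation of \<zeta> is multiplied by the decaying factor exp (- Im \<xi>), and that of G
  as well, except in the term Im (G - H).  So only Im (G - H) must be small without help from the
  exponential.\<close>

lemma tan_like_diff_le:
  assumes \<sigma>: "\<bar>\<sigma>\<bar> = 1" and im: "5 / 2 \<le> Im \<zeta>" "5 / 2 \<le> Im \<xi>" and close: "norm (\<zeta> - \<xi>) \<le> 1"
  shows "\<bar>tan_like \<sigma> G \<zeta> - tan_like \<sigma> H \<xi>\<bar> \<le>
    5 * (norm (G - H) * exp (- Im \<zeta>)) + 15 * (norm H * exp (- Im \<xi>) * norm (\<zeta> - \<xi>)) + 2 * \<bar>Im (G - H)\<bar>"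
proof -
  define w where "w = of_real \<sigma> * exp (\<i> * \<zeta>)"
  define v where "v = of_real \<sigma> * exp (\<i> * \<xi>)"
  have w: "norm w \<le> 1 / 12"
    unfolding w_def using \<sigma> im(1) by (rule exp_i_times_bound)
  have v: "norm v \<le> 1 / 12"
    unfolding v_def using \<sigma> im(2) by (rule exp_i_times_bound)
  have nw: "norm w = exp (- Im \<zeta>)" and nv: "norm v = exp (- Im \<xi>)"
    using \<sigma> by (simp_all add: w_def v_def norm_mult)
  have "w - v = v * (exp (\<i> * (\<zeta> - \<xi>)) - 1)"
    by (simp add: w_def v_def exp_diff right_diff_distrib field_simps)
  then have "norm (w - v) = exp (- Im \<xi>) * norm (exp (\<i> * (\<zeta> - \<xi>)) - 1)"
    by (simp add: norm_mult nv)
  also have "\<dots> \<le> exp (- Im \<xi>) * (3 * norm (\<zeta> - \<xi>))"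
    using norm_exp_minus_1_le[of "\<i> * (\<zeta> - \<xi>)"] close
    by (intro mult_left_mono) (auto simp: norm_mult)
  finally have wv: "norm (moebius w - moebius v) \<le> 144 / 121 * (exp (- Im \<xi>) * (3 * norm (\<zeta> - \<xi>)))"
    using norm_moebius_diff_le[OF w v] by linarith
  have a: "norm ((G - H) * moebius w) \<le> norm (G - H) * (12 / 11 * exp (- Im \<zeta>))"
    unfolding norm_mult using norm_moebius_le[OF w] nw by (intro mult_left_mono) auto
  have b: "norm (H * (moebius w - moebius v)) \<le> norm H * (144 / 121 * (exp (- Im \<xi>) * (3 * norm (\<zeta> - \<xi>))))"
    unfolding norm_mult using wv by (intro mult_left_mono) auto
  have "tan_like \<sigma> G \<zeta> - tan_like \<sigma> H \<xi>
      = 4 * Im ((G - H) * moebius w) + 4 * Im (H * (moebius w - moebius v)) - 2 * Im (G - H)"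
    unfolding tan_like_def w_def[symmetric] v_def[symmetric] by (simp add: algebra_simps)
  then have "\<bar>tan_like \<sigma> G \<zeta> - tan_like \<sigma> H \<xi>\<bar>
      \<le> 4 * norm ((G - H) * moebius w) + 4 * norm (H * (moebius w - moebius v)) + 2 * \<bar>Im (G - H)\<bar>"
    using abs_Im_le_cmod[of "(G - H) * moebius w"] abs_Im_le_cmod[of "H * (moebius w - moebius v)"] by linarith
  moreover define A where "A = norm (G - H) * exp (- Im \<zeta>)"
  moreover define B where "B = norm H * exp (- Im \<xi>) * norm (\<zeta> - \<xi>)"
  moreover have "norm ((G - H) * moebius w) \<le> 12 / 11 * A" "norm (H * (moebius w - moebius v)) \<le> 432 / 121 * B"
    using a b unfolding A_def B_def by (simp_all add: mult_ac)
  moreover have "0 \<le> A" "0 \<le> B"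
    unfolding A_def B_def by auto
  ultimately show ?thesis
    by linarith
qed

section \<open>The exact and the approximating equation\<close>

text \<open>The equation for the roots is u = arctan (exact_rhs \<sigma> q (d + u/q)); here \<sigma> = 1 belongs to f
  and \<sigma> = -1 to -h.\<close>

definition exact_rhs :: "real \<Rightarrow> real \<Rightarrow> real \<Rightarrow> real" where
  "exact_rhs \<sigma> q \<phi> = tan_like \<sigma> (ratio \<phi>) (of_real (2 * q) * branch \<phi>)"

text \<open>The second-order Taylor polynomial of the ratio, taken at d instead of d + u/q; it
  equals B1 - i C1.\<close>

definition approx_ratio :: "real \<Rightarrow> complex" where
  "approx_ratio d = 1 + \<kappa> * of_real (d\<^sup>2 / 8)"

text \<open>The equation for the first coefficient is u = arctan (model_rhs \<sigma> q d u): the branch is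
  replaced by its linear part and the ratio by its Taylor polynomial at d.\<close>

definition model_rhs :: "real \<Rightarrow> real \<Rightarrow> real \<Rightarrow> real \<Rightarrow> real" where
  "model_rhs \<sigma> q d u = tan_like \<sigma> (approx_ratio d) (of_real (2 * (q * d + u)) * \<omega>)"

lemma Re_approx_ratio: "Re (approx_ratio d) = B1 d"
  by (simp add: approx_ratio_def kappa_eq B1_def)

lemma Im_approx_ratio: "Im (approx_ratio d) = - C1 d"
  by (simp add: approx_ratio_def kappa_eq C1_def)

lemma B_C_fun_eq:
  assumes "0 < \<phi>" "\<phi> < pi"
  shows "B_fun \<phi> = sin \<phi> * Re (ratio \<phi>)" "C_fun \<phi> = - (sin \<phi> * Im (ratio \<phi>))"
proof -
  have "sin (beta \<phi>) * cis (- (pi / 3)) = of_real (sin \<phi>) * ratio \<phi> * (\<omega> * cis (- (pi / 3)))"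
    using assms by (simp add: beta_eq_branch sin_branch)
  also have "\<dots> = of_real (sin \<phi>) * ratio \<phi>"
    by (simp only: cis_mult) simp
  finally show "B_fun \<phi> = sin \<phi> * Re (ratio \<phi>)" "C_fun \<phi> = - (sin \<phi> * Im (ratio \<phi>))"
    by (simp_all add: B_fun_def C_fun_def)
qed

lemma two_qn: "2 * qn n = real n + 3"
  by (simp add: qn_def)

lemma f_fun_eq_exact_rhs:
  assumes "0 < \<phi>" "\<phi> < pi" "0 < Im (branch \<phi>)"
  shows "f_fun n \<phi> = exact_rhs 1 (qn n) \<phi>"
proof -
  have "exact_rhs 1 (qn n) \<phi> =
    2 * ((Re (ratio \<phi>) * sin ((real n + 3) * Re (branch \<phi>)) - Im (ratio \<phi>) * sinh ((real n + 3) * Im (branch \<phi>)))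
      / (cosh ((real n + 3) * Im (branch \<phi>)) + cos ((real n + 3) * Re (branch \<phi>))))"
    unfolding exact_rhs_def two_qn using assms(3)
    by (subst tan_like_eq) (auto intro!: mult_pos_pos)
  moreover have num: "sin \<phi> * r * s - sin \<phi> * i * t = sin \<phi> * (r * s - i * t)" for r s i t
    by (simp add: algebra_simps)
  moreover have "sin \<phi> \<noteq> 0"
    using assms sin_gt_zero by fastforce
  ultimately show ?thesis
    unfolding f_fun_def B_C_fun_eq[OF assms(1,2)] c_fun_def b_fun_def
    using assms by (simp add: beta_eq_branch num add.commute)
qed

lemma minus_h_fun_eq_exact_rhs:
  assumes "0 < \<phi>" "\<phi> < pi" "0 < Im (branch \<phi>)"
  shows "- h_fun n \<phi> = exact_rhs (- 1) (qn n) \<phi>"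
proof -
  have "exact_rhs (- 1) (qn n) \<phi> =
    2 * ((- (Re (ratio \<phi>) * sin ((real n + 3) * Re (branch \<phi>))) - Im (ratio \<phi>) * sinh ((real n + 3) * Im (branch \<phi>)))
      / (cosh ((real n + 3) * Im (branch \<phi>)) - cos ((real n + 3) * Re (branch \<phi>))))"
    unfolding exact_rhs_def two_qn using assms(3)
    by (subst tan_like_eq) (auto intro!: mult_pos_pos)
  also have "\<dots> = - (2 * ((Re (ratio \<phi>) * sin ((real n + 3) * Re (branch \<phi>)) + Im (ratio \<phi>) * sinh ((real n + 3) * Im (branch \<phi>)))
      / (cosh ((real n + 3) * Im (branch \<phi>)) - cos ((real n + 3) * Re (branch \<phi>)))))"
    by (simp add: field_simps minus_divide_left)
  finally have *: "exact_rhs (- 1) (qn n) \<phi> = \<dots>" .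
  have num: "sin \<phi> * r * s + sin \<phi> * i * t = sin \<phi> * (r * s + i * t)" for r s i t
    by (simp add: algebra_simps)
  have "sin \<phi> \<noteq> 0"
    using assms sin_gt_zero by fastforce
  then show ?thesis
    unfolding h_fun_def B_C_fun_eq[OF assms(1,2)] c_fun_def b_fun_def *
    using assms by (simp add: beta_eq_branch num)
qed

lemma model_rhs_eq:
  assumes "\<sigma>\<^sup>2 = 1" "0 < q * d + u"
  shows "model_rhs \<sigma> q d u = 2 * ((\<sigma> * B1 d * sin (Pa q d u) + C1 d * sinh (Pb q d u))
    / (cosh (Pb q d u) + \<sigma> * cos (Pa q d u)))"
proof -
  have "Re (of_real (2 * (q * d + u)) * \<omega>) = Pa q d u" "Im (of_real (2 * (q * d + u)) * \<omega>) = Pb q d u"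
    by (simp_all add: Pa_def Pb_def cos_60 sin_60)
  moreover from this have "0 < Im (of_real (2 * (q * d + u)) * \<omega>)"
    unfolding Pb_def using assms by simp
  ultimately show ?thesis
    unfolding model_rhs_def by (subst tan_like_eq) (auto simp: assms Re_approx_ratio Im_approx_ratio)
qed

lemma Z1_I_eq_model_rhs: "Z1_I q d u = model_rhs 1 q d u" if "0 < q * d + u"
  using that by (simp add: model_rhs_eq Z1_I_def add.commute)

lemma minus_Z1_II_eq_model_rhs: "- Z1_II q d u = model_rhs (- 1) q d u" if "0 < q * d + u"
  using that by (simp add: model_rhs_eq Z1_II_def minus_divide_left)

section \<open>The logarithmic range of frequencies\<close>

text \<open>The frequencies j admitted in the expansion have j = O(log n), so any fixed power of q d is
  at most q once n is large.  The fifth power is the largest that occurs in the estimates.  The lower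
  bound on q d keeps q d + u away from 0, so that the exponentials are small.\<close>

locale window =
  fixes \<sigma> q d :: real
  assumes sigma: "\<bar>\<sigma>\<bar> = 1"
    and pi_le: "pi \<le> q * d"
    and pow_le: "(q * d + 2) ^ 5 \<le> q"
begin

lemma q_ge: "3125 \<le> q"
proof -
  have "(5::real) ^ 5 \<le> (q * d + 2) ^ 5"
    using pi_le pi_gt3 by (intro power_mono) linarith+
  with pow_le show ?thesis
    by simp
qed

lemma d_pos: "0 < d"
  using pi_le pi_gt_zero q_ge by (smt (verit, best) mult_nonneg_nonpos)

lemma window_le:
  assumes "0 \<le> y" "y \<le> q * d + 2" "k \<le> 5"
  shows "y ^ k \<le> q"
proof -
  have "y ^ k \<le> (q * d + 2) ^ k"
    using assms by (intro power_mono)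
  also have "\<dots> \<le> (q * d + 2) ^ 5"
    using assms pi_le pi_gt3 by (intro power_increasing) linarith+
  also note pow_le
  finally show ?thesis .
qed

end

locale window_point = window +
  fixes u :: real
  assumes u: "\<bar>u\<bar> \<le> pi / 2"
begin

definition x :: real where "x = q * d + u"

lemma x_bounds: "3 / 2 \<le> x" "q * d \<le> 2 * x" "\<bar>u\<bar> \<le> x" "x \<le> q * d + 2" "\<bar>u\<bar> \<le> 2"
proof -
  have "- (pi / 2) \<le> u" "u \<le> pi / 2"
    using u by (simp_all add: abs_le_iff)
  note facts = this pi_le pi_gt3 pi_less_4
  show "3 / 2 \<le> x"
    unfolding x_def using facts by linarith
  show "q * d \<le> 2 * x"
    unfolding x_def distrib_left using facts by linarith
  show "\<bar>u\<bar> \<le> x"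
    unfolding x_def using facts by linarith
  show "x \<le> q * d + 2"
    unfolding x_def using facts by linarith
  show "\<bar>u\<bar> \<le> 2"
    using facts by linarith
qed

lemma x_power_le: "k \<le> 5 \<Longrightarrow> x ^ k \<le> q"
  using x_bounds by (intro window_le) auto

lemma phi_eq: "d + u / q = x / q"
  using q_ge by (simp add: x_def field_simps)

lemma phi_bounds: "0 < x / q" "x / q \<le> 1" "x / q < pi"
proof -
  show "0 < x / q"
    using x_bounds q_ge by simp
  show "x / q \<le> 1"
    using x_power_le[of 1] q_ge by simp
  then show "x / q < pi"
    using pi_gt3 by linarith
qed

lemma power_over_q_le:
  assumes "k \<le> 5" "0 < m"
  shows "x ^ k / q ^ Suc m \<le> 1 / q ^ m"
  using x_power_le[OF assms(1)] q_ge by (simp add: field_simps)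

text \<open>The cubic error of the branch at x/q, magnified by 2q, is only O(x^3/q^2).\<close>

lemma exponent_close:
  "norm (of_real (2 * q) * branch (x / q) - of_real (2 * x) * \<omega>) \<le> 2 * x ^ 3 / q\<^sup>2"
proof -
  have "of_real (2 * q) * branch (x / q) - of_real (2 * x) * \<omega>
      = of_real (2 * q) * (branch (x / q) - \<omega> * of_real (x / q))"
    using q_ge by (simp add: field_simps)
  also have "norm \<dots> = 2 * q * norm (branch (x / q) - \<omega> * of_real (x / q))"
    using q_ge unfolding norm_mult norm_of_real by simp
  also have "\<dots> \<le> 2 * q * (x / q) ^ 3"
    using phi_bounds q_ge by (intro mult_left_mono norm_branch_minus_le) auto
  also have "\<dots> = 2 * x ^ 3 / q\<^sup>2"
    using q_ge by (simp add: power_divide power2_eq_square power3_eq_cube)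
  finally show ?thesis .
qed

lemma exponent_error_small: "2 * x ^ 3 / q\<^sup>2 \<le> 1 / 1000"
proof -
  have "2 * x ^ 3 / q\<^sup>2 \<le> 2 / q"
    using power_over_q_le[of 3 1] by (simp add: numeral_2_eq_2)
  also have "\<dots> \<le> 2 / 3125"
    using q_ge by (intro divide_left_mono) auto
  finally show ?thesis
    by simp
qed

lemma sqrt3_ge: "173 / 100 \<le> sqrt 3"
  by (rule real_le_rsqrt) (simp add: power2_eq_square)

lemma sqrt3_le: "sqrt 3 \<le> 174 / 100"
  by (rule real_le_lsqrt) (simp_all add: power2_eq_square)

lemma Im_model_exponent: "Im (of_real (2 * x) * \<omega>) = sqrt 3 * x"
  by (simp add: sin_60)

lemma model_exponent_ge: "5 / 2 \<le> Im (of_real (2 * x) * \<omega>)" "x \<le> Im (of_real (2 * x) * \<omega>)"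
  using mult_right_mono[OF sqrt3_ge, of x] x_bounds unfolding Im_model_exponent by linarith+

text \<open>Up to an error below 1/1000 the imaginary part is sqrt 3 times x, and x \<ge> 3/2.\<close>

lemma exact_exponent_ge:
  "5 / 2 \<le> Im (of_real (2 * q) * branch (x / q))" "x \<le> Im (of_real (2 * q) * branch (x / q))"
proof -
  have "\<bar>Im (of_real (2 * q) * branch (x / q)) - Im (of_real (2 * x) * \<omega>)\<bar> \<le> 1 / 1000"
    using abs_Im_le_cmod[of "of_real (2 * q) * branch (x / q) - of_real (2 * x) * \<omega>"]
      exponent_close exponent_error_small unfolding minus_complex.sel by linarith
  then show "5 / 2 \<le> Im (of_real (2 * q) * branch (x / q))" "x \<le> Im (of_real (2 * q) * branch (x / q))"
    using mult_right_mono[OF sqrt3_ge, of x] x_bounds unfolding Im_model_exponent by linarith+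
qed

lemma Im_branch_pos: "0 < Im (branch (x / q))"
proof (rule zero_less_mult_pos)
  show "0 < 2 * q * Im (branch (x / q))"
    using exact_exponent_ge(1) by simp
qed (use q_ge in simp)

lemma d_sq_le: "d\<^sup>2 \<le> 4 * x\<^sup>2 / q\<^sup>2"
proof -
  have "d \<le> 2 * x / q"
    using x_bounds(2) q_ge by (simp add: field_simps)
  then have "d\<^sup>2 \<le> (2 * x / q)\<^sup>2"
    using d_pos by (intro power_mono) auto
  then show ?thesis
    by (simp add: power_divide power_mult_distrib)
qed

lemma d_sq_small: "d\<^sup>2 \<le> 1 / 500"
proof -
  have "4 * (x\<^sup>2 / q\<^sup>2) \<le> 4 * (1 / q)"
    using power_over_q_le[of 2 1] by (simp add: numeral_2_eq_2)
  also have "\<dots> \<le> 4 * (1 / 3125)"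
    using q_ge by (intro mult_left_mono divide_left_mono) auto
  finally show ?thesis
    using d_sq_le by simp
qed

lemma norm_approx_ratio_minus_1: "norm (approx_ratio d - 1) \<le> d\<^sup>2 / 4"
proof -
  have "norm (approx_ratio d - 1) = norm \<kappa> * (d\<^sup>2 / 8)"
    unfolding approx_ratio_def add_diff_cancel_left' norm_mult norm_of_real by simp
  also have "\<dots> \<le> 2 * (d\<^sup>2 / 8)"
    using norm_kappa_le by (intro mult_right_mono) auto
  finally show ?thesis
    by simp
qed

lemma norm_approx_ratio_le: "norm (approx_ratio d) \<le> 1001 / 1000"
  using norm_approx_ratio_minus_1 d_sq_small norm_triangle_ineq[of "approx_ratio d - 1" 1]
  by simp

end

section \<open>Comparison of the two equations\<close>

lemma lipschitz_from_derivative_bound: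
  fixes f :: "real \<Rightarrow> real"
  assumes der: "\<And>u. \<bar>u\<bar> \<le> r \<Longrightarrow> \<exists>D. (f has_real_derivative D) (at u) \<and> \<bar>D\<bar> \<le> L"
    and "\<bar>a\<bar> \<le> r" "\<bar>b\<bar> \<le> r"
  shows "\<bar>f a - f b\<bar> \<le> L * \<bar>a - b\<bar>"
proof -
  obtain D where D: "\<And>u. \<bar>u\<bar> \<le> r \<Longrightarrow> (f has_real_derivative D u) (at u) \<and> \<bar>D u\<bar> \<le> L"
    using der by metis
  have "norm (f a - f b) \<le> L * norm (a - b)"
  proof (rule field_differentiable_bound[where S = "{-r..r}" and f' = D])
    fix z assume "z \<in> {-r..r}"
    then have "\<bar>z\<bar> \<le> r"
      by auto
    then show "(f has_real_derivative D z) (at z within {-r..r})" "norm (D z) \<le> L"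
      using D by (auto intro: has_field_derivative_at_within)
  qed (use assms in auto)
  then show ?thesis
    by simp
qed

context window_point
begin

text \<open>Along \<phi> = d + u/q the exponent 2 q \<beta> has derivative 2 \<omega> / G.  Its product with G is
  2 \<omega> of norm 2, which gives 96/121 < 4/5; the derivative of G contributes only O(1/q).\<close>

lemma exact_rhs_derivative:
  "\<exists>D. ((\<lambda>u. exact_rhs \<sigma> q (d + u / q)) has_real_derivative D) (at u) \<and> \<bar>D\<bar> \<le> 9 / 10"
proof -
  define G' where "G' = \<kappa> * of_real (tan ((x / q) / 2) * (1 + (tan ((x / q) / 2))\<^sup>2) / 2) / ratio (x / q)"
  have inner: "((\<lambda>u. d + u / q) has_vector_derivative 1 / q) (at u)"
    unfolding has_real_derivative_iff_has_vector_derivative[symmetric]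
    by (rule derivative_eq_intros refl | simp)+ (use q_ge in auto)
  have "(ratio has_vector_derivative G') (at (d + u / q))"
    unfolding phi_eq G'_def using phi_bounds by (intro ratio_has_vector_derivative) auto
  from vector_diff_chain_at[OF inner this]
  have G: "((\<lambda>u. ratio (d + u / q)) has_vector_derivative (1 / q) *\<^sub>R G') (at u)"
    by (simp add: o_def)
  have "(branch has_vector_derivative \<omega> / ratio (x / q)) (at (d + u / q))"
    unfolding phi_eq using phi_bounds by (intro branch_has_vector_derivative) auto
  from vector_diff_chain_at[OF inner this]
  have "((\<lambda>u. branch (d + u / q)) has_vector_derivative (1 / q) *\<^sub>R (\<omega> / ratio (x / q))) (at u)"
    by (simp add: o_def)
  then have \<zeta>: "((\<lambda>u. of_real (2 * q) * branch (d + u / q)) has_vector_derivative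
      of_real (2 * q) * ((1 / q) *\<^sub>R (\<omega> / ratio (x / q)))) (at u)"
    by (rule has_vector_derivative_mult_right)
  have im: "5 / 2 \<le> Im (of_real (2 * q) * branch (d + u / q))"
    unfolding phi_eq by (rule exact_exponent_ge)
  obtain D where D: "((\<lambda>u. tan_like \<sigma> (ratio (d + u / q)) (of_real (2 * q) * branch (d + u / q))) has_real_derivative D) (at u)"
    "\<bar>D\<bar> \<le> 3 * norm ((1 / q) *\<^sub>R G')
       + 48 / 121 * norm (ratio (d + u / q) * (of_real (2 * q) * ((1 / q) *\<^sub>R (\<omega> / ratio (x / q)))))"
    by (rule tan_like_has_derivative[OF sigma im G \<zeta>])
  have "ratio (d + u / q) * (of_real (2 * q) * ((1 / q) *\<^sub>R (\<omega> / ratio (x / q)))) = 2 * \<omega>"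
    unfolding phi_eq using ratio_nonzero[of "x / q"] q_ge by (simp add: scaleR_conv_of_real field_simps)
  then have "norm (ratio (d + u / q) * (of_real (2 * q) * ((1 / q) *\<^sub>R (\<omega> / ratio (x / q))))) = 2"
    by (simp add: norm_mult)
  moreover have "norm ((1 / q) *\<^sub>R G') \<le> (1 / 3125) * 2"
    unfolding norm_scaleR
  proof (rule mult_mono)
    show "\<bar>1 / q\<bar> \<le> 1 / 3125"
      using q_ge by (simp add: field_simps)
    show "norm G' \<le> 2"
      unfolding G'_def using phi_bounds by (intro norm_ratio_deriv_le) auto
  qed auto
  ultimately show ?thesis
    using D unfolding exact_rhs_def by (intro exI[of _ D]) auto
qed

lemma model_rhs_derivative:
  "\<exists>D. (model_rhs \<sigma> q d has_real_derivative D) (at u) \<and> \<bar>D\<bar> \<le> 9 / 10"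
proof -
  have G: "((\<lambda>u. approx_ratio d) has_vector_derivative 0) (at u)"
    by simp
  have \<zeta>: "((\<lambda>u. of_real (2 * (q * d + u)) * \<omega>) has_vector_derivative of_real 2 * \<omega>) (at u)"
    by (intro has_vector_derivative_mult_left has_vector_derivative_of_real
        has_vector_derivative_real_field) (auto intro!: derivative_eq_intros)
  obtain D where D: "((\<lambda>u. tan_like \<sigma> (approx_ratio d) (of_real (2 * (q * d + u)) * \<omega>)) has_real_derivative D) (at u)"
    "\<bar>D\<bar> \<le> 3 * norm (0 :: complex) + 48 / 121 * norm (approx_ratio d * (of_real 2 * \<omega>))"
    by (rule tan_like_has_derivative[OF sigma model_exponent_ge(1)[unfolded x_def] G \<zeta>])
  have "norm (approx_ratio d * (of_real 2 * \<omega>)) = norm (approx_ratio d) * 2"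
    by (simp add: norm_mult)
  then have "\<bar>D\<bar> \<le> 9 / 10"
    using D(2) norm_approx_ratio_le by simp
  with D(1) show ?thesis
    unfolding model_rhs_def by blast
qed

lemma exp_minus_model_exponent_le: "exp (- Im (of_real (2 * x) * \<omega>)) \<le> exp (- x)"
  using model_exponent_ge(2) by simp

lemma C1_le: "0 \<le> C1 d" "C1 d \<le> d\<^sup>2 / 8"
proof -
  show "0 \<le> C1 d"
    by (simp add: C1_def)
  have "sqrt 3 / 16 * d\<^sup>2 \<le> 2 / 16 * d\<^sup>2"
    using sqrt3_le by (intro mult_right_mono) auto
  then show "C1 d \<le> d\<^sup>2 / 8"
    by (simp add: C1_def)
qed

text \<open>At the fixed point u is bounded by the right-hand side, which is O(exp (- x) + d^2).  Hence
  the product of u with q d \<le> 2x stays bounded although q d itself is unbounded.\<close>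

lemma model_fixed_point_small:
  assumes fix_u: "u = arctan (model_rhs \<sigma> q d u)"
  shows "q * d * \<bar>u\<bar> \<le> 14"
proof -
  have "\<bar>u\<bar> \<le> \<bar>model_rhs \<sigma> q d u\<bar>"
    using abs_arctan_diff_le[of "model_rhs \<sigma> q d u" 0] fix_u by simp
  also have "\<dots> \<le> 5 * (norm (approx_ratio d) * exp (- Im (of_real (2 * x) * \<omega>))) + 2 * \<bar>Im (approx_ratio d)\<bar>"
    unfolding model_rhs_def x_def[symmetric]
    using sigma model_exponent_ge(1) by (rule abs_tan_like_le)
  also have "\<dots> \<le> 5 * (1001 / 1000 * exp (- x)) + 2 * (d\<^sup>2 / 8)"
    using norm_approx_ratio_le exp_minus_model_exponent_le C1_le
    by (intro add_mono mult_mono mult_left_mono) (auto simp: Im_approx_ratio)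
  also have "\<dots> \<le> 6 * exp (- x) + x\<^sup>2 / q\<^sup>2"
  proof -
    have "d\<^sup>2 \<le> 4 * (x\<^sup>2 / q\<^sup>2)"
      using d_sq_le by simp
    then show ?thesis
      using exp_ge_zero[of "- x"] by linarith
  qed
  finally have "\<bar>u\<bar> \<le> 6 * exp (- x) + x\<^sup>2 / q\<^sup>2" .
  then have "q * d * \<bar>u\<bar> \<le> 2 * x * (6 * exp (- x) + x\<^sup>2 / q\<^sup>2)"
    using x_bounds pi_le pi_gt_zero
    by (intro mult_mono[of "q * d" "2 * x" "\<bar>u\<bar>"]) auto
  also have "\<dots> = 12 * (x ^ 1 * exp (- x)) + 2 * (x ^ 3 / q\<^sup>2)"
    by (simp add: algebra_simps power2_eq_square power3_eq_cube)
  also have "\<dots> \<le> 12 * 1 + 2 * (1 / q)"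
    using power_exp_minus_le[of x 1] x_bounds power_over_q_le[of 3 1]
    by (intro add_mono mult_left_mono) (auto simp: numeral_2_eq_2)
  also have "\<dots> \<le> 14"
    using q_ge by (simp add: field_simps)
  finally show ?thesis .
qed

lemma ratio_minus_approx_ratio_le: "norm (ratio (x / q) - approx_ratio d) \<le> 2 * x\<^sup>2 / q\<^sup>2"
proof -
  have "norm (ratio (x / q) - approx_ratio d) \<le> norm (ratio (x / q) - 1) + norm (approx_ratio d - 1)"
    using norm_triangle_ineq4[of "ratio (x / q) - 1" "approx_ratio d - 1"] by simp
  also have "\<dots> \<le> (x / q)\<^sup>2 + d\<^sup>2 / 4"
    using phi_bounds by (intro add_mono norm_ratio_minus_1_le norm_approx_ratio_minus_1) auto
  also have "\<dots> \<le> 2 * x\<^sup>2 / q\<^sup>2"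
    using d_sq_le by (simp add: power_divide)
  finally show ?thesis .
qed

text \<open>The Taylor polynomial is evaluated at d instead of x/q = d + u/q.  The resulting error is
  governed by (x/q)^2 - d^2 = (2 q d u + u^2) / q^2, which is O(1/q^2) only because q d u is
  bounded.\<close>

lemma ratio_minus_approx_ratio_fine:
  assumes small: "q * d * \<bar>u\<bar> \<le> 14"
  shows "norm (ratio (x / q) - approx_ratio d) \<le> 10 / q\<^sup>2"
proof -
  have "norm (ratio (x / q) - approx_ratio d)
      = norm ((ratio (x / q) - 1 - \<kappa> * of_real ((x / q)\<^sup>2 / 8)) + \<kappa> * of_real (((x / q)\<^sup>2 - d\<^sup>2) / 8))"
    unfolding approx_ratio_def by (simp add: algebra_simps diff_divide_distrib)
  also have "\<dots> \<le> norm (ratio (x / q) - 1 - \<kappa> * of_real ((x / q)\<^sup>2 / 8))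
      + norm (\<kappa> * of_real (((x / q)\<^sup>2 - d\<^sup>2) / 8))"
    by (rule norm_triangle_ineq)
  also have "\<dots> \<le> 2 * (x / q) ^ 4 + 2 * (\<bar>(x / q)\<^sup>2 - d\<^sup>2\<bar> / 8)"
  proof (rule add_mono)
    show "norm (ratio (x / q) - 1 - \<kappa> * of_real ((x / q)\<^sup>2 / 8)) \<le> 2 * (x / q) ^ 4"
      using phi_bounds by (intro norm_ratio_second_order) auto
    show "norm (\<kappa> * of_real (((x / q)\<^sup>2 - d\<^sup>2) / 8)) \<le> 2 * (\<bar>(x / q)\<^sup>2 - d\<^sup>2\<bar> / 8)"
      unfolding norm_mult norm_of_real using norm_kappa_le by (intro mult_mono) auto
  qed
  also have "(x / q)\<^sup>2 - d\<^sup>2 = (2 * (q * d * u) + u\<^sup>2) / q\<^sup>2"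
    unfolding phi_eq[symmetric] using q_ge by (simp add: field_simps power2_eq_square)
  also have "2 * (x / q) ^ 4 + 2 * (\<bar>(2 * (q * d * u) + u\<^sup>2) / q\<^sup>2\<bar> / 8) \<le> 2 * (1 / q\<^sup>2) + 8 / q\<^sup>2"
  proof (rule add_mono)
    have "x ^ 4 / q ^ 4 \<le> 1 / q ^ 3"
      using power_over_q_le[of 4 3] by (simp add: eval_nat_numeral)
    also have "\<dots> \<le> 1 / q\<^sup>2"
      using q_ge by (intro divide_left_mono power_increasing) auto
    finally show "2 * (x / q) ^ 4 \<le> 2 * (1 / q\<^sup>2)"
      by (simp add: power_divide)
    have "u\<^sup>2 \<le> 2\<^sup>2"
      using x_bounds(5) abs_le_square_iff[of u 2] by simp
    moreover have "\<bar>q * d * u\<bar> \<le> 14"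
      using small d_pos q_ge by (simp add: abs_mult)
    ultimately have "\<bar>2 * (q * d * u) + u\<^sup>2\<bar> \<le> 32"
      by (simp add: abs_le_iff) (smt (verit, best) zero_le_power2)
    then have "\<bar>2 * (q * d * u) + u\<^sup>2\<bar> / q\<^sup>2 \<le> 32 / q\<^sup>2"
      by (intro divide_right_mono) auto
    then show "2 * (\<bar>(2 * (q * d * u) + u\<^sup>2) / q\<^sup>2\<bar> / 8) \<le> 8 / q\<^sup>2"
      by (simp add: abs_divide)
  qed
  finally show ?thesis
    by simp
qed

text \<open>Every power of x that arises is absorbed by exp (- x), except in the imaginary part of the
  difference of the ratios, where the finer bound is used.\<close>

lemma exact_minus_model_le:
  assumes small: "q * d * \<bar>u\<bar> \<le> 14"
  shows "\<bar>exact_rhs \<sigma> q (d + u / q) - model_rhs \<sigma> q d u\<bar> \<le> 300 / q\<^sup>2"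
proof -
  let ?\<zeta> = "of_real (2 * q) * branch (x / q)" and ?\<xi> = "of_real (2 * x) * \<omega>"
  have "norm (?\<zeta> - ?\<xi>) \<le> 1"
    using exponent_close exponent_error_small by linarith
  then have "\<bar>exact_rhs \<sigma> q (d + u / q) - model_rhs \<sigma> q d u\<bar> \<le>
      5 * (norm (ratio (x / q) - approx_ratio d) * exp (- Im ?\<zeta>))
      + 15 * (norm (approx_ratio d) * exp (- Im ?\<xi>) * norm (?\<zeta> - ?\<xi>))
      + 2 * \<bar>Im (ratio (x / q) - approx_ratio d)\<bar>"
    unfolding phi_eq exact_rhs_def model_rhs_def x_def[symmetric]
    by (rule tan_like_diff_le[OF sigma exact_exponent_ge(1) model_exponent_ge(1)])
  also have "\<dots> \<le> 5 * (2 * x\<^sup>2 / q\<^sup>2 * exp (- x))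
      + 15 * (1001 / 1000 * exp (- x) * (2 * x ^ 3 / q\<^sup>2)) + 2 * (10 / q\<^sup>2)"
  proof (intro add_mono mult_left_mono mult_mono)
    show "\<bar>Im (ratio (x / q) - approx_ratio d)\<bar> \<le> 10 / q\<^sup>2"
      using abs_Im_le_cmod ratio_minus_approx_ratio_fine[OF small] by (rule order_trans)
  qed (use ratio_minus_approx_ratio_le exact_exponent_ge(2) norm_approx_ratio_le
      exp_minus_model_exponent_le exponent_close x_bounds(1) in auto)
  also have "\<dots> = (10 * (x ^ 2 * exp (- x)) + 30 * 1001 / 1000 * (x ^ 3 * exp (- x)) + 20) / q\<^sup>2"
    by (simp add: add_divide_distrib mult_ac)
  also have "\<dots> \<le> 300 / q\<^sup>2"
    using power_exp_minus_le[of x 2] power_exp_minus_le[of x 3] x_bounds(1)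
    by (intro divide_right_mono) (auto simp: fact_numeral)
  finally show ?thesis .
qed

end

section \<open>The second-order coefficient\<close>

text \<open>In the application N / D is Z1 or -Z1 and k is cosh at the point u: X1 and Y1 are N and D divided by k,
  whereas X3 and Y3 are the derivatives of N and D divided by the same k, and so not the derivatives of
  X1 and Y1.  Since k cancels, Z3 is nevertheless the derivative of N / D.\<close>

lemma quotient_derivative_scaled:
  fixes N D :: "real \<Rightarrow> real"
  assumes N: "(N has_real_derivative X3 * k) (at u)" and D: "(D has_real_derivative Y3 * k) (at u)"
    and eq: "N u = X1 * k" "D u = Y1 * k" and nz: "k \<noteq> 0" "Y1 \<noteq> 0"
  shows "((\<lambda>u. N u / D u) has_real_derivative (X3 * Y1 - X1 * Y3) / Y1\<^sup>2) (at u)"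
proof -
  have "((\<lambda>u. N u / D u) has_real_derivative (X3 * k * D u - N u * (Y3 * k)) / (D u * D u)) (at u)"
    using N D eq nz by (intro DERIV_divide) auto
  also have "(X3 * k * D u - N u * (Y3 * k)) / (D u * D u) = (X3 * Y1 - X1 * Y3) / Y1\<^sup>2"
    unfolding eq using nz by (simp add: field_simps power2_eq_square)
  finally show ?thesis .
qed

lemma Y1_nonzero: "1 + \<sigma> * cos a / cosh b \<noteq> 0"
  if "\<bar>\<sigma>\<bar> = 1" "b \<noteq> 0" for \<sigma> a b :: real
proof -
  have "\<bar>\<sigma> * cos a\<bar> \<le> 1"
    using that by (simp add: abs_mult)
  moreover have "1 < cosh b"
    using cosh_real_strict_mono[of 0 "\<bar>b\<bar>"] that by simp
  ultimately show ?thesis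
    by (simp add: field_simps abs_le_iff)
qed

lemma Z1_I_derivative:
  assumes "0 < q * d + u"
  shows "(Z1_I q d has_real_derivative Z3_I q d u) (at u)"
proof -
  let ?a = "Pa q d u" and ?b = "Pb q d u"
  have ch: "cosh ?b \<noteq> 0" and b: "?b \<noteq> 0"
    using assms by (simp_all add: Pb_def)
  have "((\<lambda>u. 2 * (B1 d * sin (Pa q d u) + C1 d * sinh (Pb q d u))
        / (cos (Pa q d u) + cosh (Pb q d u))) has_real_derivative Z3_I q d u) (at u)"
    unfolding Z3_I_def
  proof (rule quotient_derivative_scaled[where k = "cosh ?b"])
    show "((\<lambda>u. 2 * (B1 d * sin (Pa q d u) + C1 d * sinh (Pb q d u)))
        has_real_derivative X3_I q d u * cosh ?b) (at u)"
      unfolding Pa_def Pb_def X3_I_def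
      by (auto intro!: derivative_eq_intros simp: field_simps)
    show "((\<lambda>u. cos (Pa q d u) + cosh (Pb q d u)) has_real_derivative Y3_I q d u * cosh ?b) (at u)"
      unfolding Pa_def Pb_def Y3_I_def
      by (auto intro!: derivative_eq_intros simp: field_simps)
    show "2 * (B1 d * sin ?a + C1 d * sinh ?b) = X1_I q d u * cosh ?b"
      using ch by (simp add: X1_I_def field_simps)
    show "cos ?a + cosh ?b = Y1_I q d u * cosh ?b"
      using ch by (simp add: Y1_I_def field_simps)
    show "Y1_I q d u \<noteq> 0"
      using Y1_nonzero[OF _ b, of 1] by (simp add: Y1_I_def)
  qed (rule ch)
  then show ?thesis
    unfolding Z1_I_def[abs_def] by simp
qed

lemma minus_Z1_II_derivative:
  assumes "0 < q * d + u"
  shows "((\<lambda>u. - Z1_II q d u) has_real_derivative Z3_II q d u) (at u)"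
proof -
  let ?a = "Pa q d u" and ?b = "Pb q d u"
  have ch: "cosh ?b \<noteq> 0" and b: "?b \<noteq> 0"
    using assms by (simp_all add: Pb_def)
  have "((\<lambda>u. 2 * (- (B1 d * sin (Pa q d u)) + C1 d * sinh (Pb q d u))
        / (- cos (Pa q d u) + cosh (Pb q d u))) has_real_derivative Z3_II q d u) (at u)"
    unfolding Z3_II_def
  proof (rule quotient_derivative_scaled[where k = "cosh ?b"])
    show "((\<lambda>u. 2 * (- (B1 d * sin (Pa q d u)) + C1 d * sinh (Pb q d u)))
        has_real_derivative X3_II q d u * cosh ?b) (at u)"
      unfolding Pa_def Pb_def X3_II_def
      by (auto intro!: derivative_eq_intros simp: field_simps)
    show "((\<lambda>u. - cos (Pa q d u) + cosh (Pb q d u)) has_real_derivative Y3_II q d u * cosh ?b) (at u)"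
      unfolding Pa_def Pb_def Y3_II_def
      by (auto intro!: derivative_eq_intros simp: field_simps)
    show "2 * (- (B1 d * sin ?a) + C1 d * sinh ?b) = X1_II q d u * cosh ?b"
      using ch by (simp add: X1_II_def field_simps)
    show "- cos ?a + cosh ?b = Y1_II q d u * cosh ?b"
      using ch by (simp add: Y1_II_def field_simps)
    show "Y1_II q d u \<noteq> 0"
      using Y1_nonzero[OF _ b, of "-1"] by (simp add: Y1_II_def)
  qed (rule ch)
  moreover have "2 * (- (B1 d * sin a) + C1 d * sinh b) / (- cos a + cosh b)
    = - (2 * ((B1 d * sin a - C1 d * sinh b) / (- cos a + cosh b)))" for a b :: real
    by (simp add: minus_divide_left)
  ultimately show ?thesis
    unfolding Z1_II_def by simp
qed

context window_point
begin

text \<open>This bounds Z3 away from 1, and with it the denominator 1 + Z1^2 - Z3 of the second-order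
  coefficient away from 0.\<close>

lemma model_derivative_le:
  assumes Z: "(Z has_real_derivative Z') (at u)"
    and eq: "\<And>v. 0 < q * d + v \<Longrightarrow> Z v = model_rhs \<sigma> q d v"
  shows "Z' \<le> 9 / 10"
proof -
  obtain D where D: "(model_rhs \<sigma> q d has_real_derivative D) (at u)" "\<bar>D\<bar> \<le> 9 / 10"
    using model_rhs_derivative by blast
  have "(Z has_real_derivative D) (at u)"
  proof (rule has_field_derivative_transform_within_open[OF D(1)])
    show "open {- (q * d)<..}" "u \<in> {- (q * d)<..}"
      using x_bounds(1) by (auto simp: x_def)
  qed (auto simp: eq)
  then have "D = Z'"
    using Z by (rule DERIV_unique)
  with D show ?thesis
    by simp
qed

lemma inverse_cosh_le: "1 / cosh (Pb q d u) \<le> 2 * exp (- x)" "1 / cosh (Pb q d u) \<le> 1 / 6"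
proof -
  let ?e = "exp (- Im (of_real (2 * x) * \<omega>))"
  have Pb: "Pb q d u = Im (of_real (2 * x) * \<omega>)"
    unfolding Im_model_exponent by (simp add: Pb_def x_def)
  have "exp (Pb q d u) / 2 \<le> cosh (Pb q d u)"
    by (simp add: cosh_def)
  then have "1 / cosh (Pb q d u) \<le> 1 / (exp (Pb q d u) / 2)"
    by (intro divide_left_mono) auto
  also have "\<dots> = 2 * ?e"
    unfolding Pb by (simp add: exp_minus field_simps)
  finally have le: "1 / cosh (Pb q d u) \<le> 2 * ?e" .
  then show "1 / cosh (Pb q d u) \<le> 2 * exp (- x)"
    using exp_minus_model_exponent_le by linarith
  have "?e \<le> 1 / 12"
    using exp_i_times_bound[of 1 "of_real (2 * x) * \<omega>"] model_exponent_ge(1) by (simp add: norm_mult)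
  with le show "1 / cosh (Pb q d u) \<le> 1 / 6"
    by linarith
qed

text \<open>The cubic in Q is (x^3 - u^3)/q, and |u| \<le> x.\<close>

lemma Q_bounds: "\<bar>Qa q d u\<bar> \<le> x ^ 3 / q" "\<bar>Qb q d u\<bar> \<le> x ^ 3 / q"
proof -
  have cubic: "d ^ 3 * q\<^sup>2 + 3 * d\<^sup>2 * u * q + 3 * d * u\<^sup>2 = (x ^ 3 - u ^ 3) / q"
    unfolding x_def using q_ge by (simp add: field_simps power2_eq_square power3_eq_cube)
  have "\<bar>u ^ 3\<bar> \<le> x ^ 3"
    unfolding power_abs using x_bounds(3) by (intro power_mono) auto
  then have "\<bar>x ^ 3 - u ^ 3\<bar> \<le> 2 * x ^ 3"
    by (simp add: abs_le_iff)
  then have *: "\<bar>(x ^ 3 - u ^ 3) / q\<bar> \<le> 2 * x ^ 3 / q"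
    using q_ge by (simp add: abs_divide divide_right_mono)
  have "\<bar>Qa q d u\<bar> = 1 / 8 * \<bar>(x ^ 3 - u ^ 3) / q\<bar>"
    unfolding Qa_def cubic abs_mult by simp
  also have "\<dots> \<le> 1 / 2 * (2 * x ^ 3 / q)"
    using * by (intro mult_mono) auto
  finally show "\<bar>Qa q d u\<bar> \<le> x ^ 3 / q"
    by simp
  have "\<bar>Qb q d u\<bar> = sqrt 3 / 24 * \<bar>(x ^ 3 - u ^ 3) / q\<bar>"
    unfolding Qb_def cubic abs_mult by simp
  also have "\<dots> \<le> 1 / 2 * (2 * x ^ 3 / q)"
    using * sqrt3_le by (intro mult_mono) auto
  finally show "\<bar>Qb q d u\<bar> \<le> x ^ 3 / q"
    by simp
qed

text \<open>Both cases are covered by S = \<sigma> sin/cosh, A = \<sigma> cos/cosh and T = tanh.  Each term carries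
  a factor 1/q times a power of x, and this power is compensated: by exp (- x) in the terms with
  S or A, by the boundedness of q d u in the terms with B2 and C2, and by C1 = O(x^2/q^2) in the
  others.\<close>

lemma second_order_numerator_le:
  fixes S A T :: real
  assumes small: "q * d * \<bar>u\<bar> \<le> 14"
    and S: "\<bar>S\<bar> \<le> 2 * exp (- x)" and A: "\<bar>A\<bar> \<le> 2 * exp (- x)" "\<bar>A\<bar> \<le> 1 / 6" and T: "\<bar>T\<bar> \<le> 1"
    and X1: "X1 = 2 * (S * B1 d + T * C1 d)"
    and X2: "X2 = 2 * (S * B2 d u + B1 d * (Qa q d u * A) + T * C2 d u + C1 d * Qb q d u)"
    and Y1: "Y1 = 1 + A" and Y2: "Y2 = - (Qa q d u * S) + Qb q d u * T"
  shows "\<bar>(X2 * Y1 - X1 * Y2) / Y1\<^sup>2\<bar> \<le> 2000 / q"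
proof -
  have q: "0 < q"
    using q_ge by simp
  have e: "0 < exp (- x)"
    by simp
  have x0: "0 \<le> x" "0 \<le> x ^ 3 / q"
    using x_bounds(1) q by auto
  have d0: "0 < d"
    by (rule d_pos)
  have x3e: "x ^ 3 * exp (- x) \<le> 6"
    using power_exp_minus_le[of x 3] x0 by (simp add: fact_numeral)
  have S2: "\<bar>S\<bar> \<le> 2"
  proof -
    have "exp (- x) \<le> 1"
      using x0 by simp
    with S show ?thesis
      by linarith
  qed
  have du: "d * \<bar>u\<bar> \<le> 14 / q"
    using small q by (simp add: field_simps)
  have B1: "0 \<le> B1 d" "B1 d \<le> 2"
    using d_sq_small by (simp_all add: B1_def)
  have C1: "0 \<le> C1 d" "C1 d \<le> x\<^sup>2 / q\<^sup>2"
    using C1_le d_sq_le zero_le_power2[of x] q by (auto intro: order_trans)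
  have C1_Q: "C1 d * (x ^ 3 / q) \<le> 1 / q"
  proof -
    have "C1 d * (x ^ 3 / q) \<le> x\<^sup>2 / q\<^sup>2 * (x ^ 3 / q)"
      using C1 x0 by (intro mult_right_mono) auto
    also have "\<dots> = x ^ 5 / q ^ 3"
      by (simp add: eval_nat_numeral)
    also have "\<dots> \<le> 1 / q\<^sup>2"
      using power_over_q_le[of 5 2] by (simp add: eval_nat_numeral)
    also have "\<dots> \<le> 1 / q"
      using q_ge power_increasing[of 1 2 q] by (intro divide_left_mono) auto
    finally show ?thesis .
  qed
  have "\<bar>S * B2 d u\<bar> \<le> 2 * (14 / q)"
  proof -
    have "\<bar>B2 d u\<bar> = 3 / 8 * (d * \<bar>u\<bar>)"
      using d0 by (simp add: B2_def abs_mult)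
    then have "\<bar>B2 d u\<bar> \<le> 14 / q"
      using du d0 mult_nonneg_nonneg[of d "\<bar>u\<bar>"] by linarith
    then show ?thesis
      unfolding abs_mult using S2 by (intro mult_mono) auto
  qed
  moreover have "\<bar>B1 d * (Qa q d u * A)\<bar> \<le> 24 / q"
  proof -
    have "\<bar>B1 d * (Qa q d u * A)\<bar> \<le> 2 * (x ^ 3 / q * (2 * exp (- x)))"
      unfolding abs_mult using B1 Q_bounds A x0 by (intro mult_mono) auto
    also have "\<dots> = 4 * (x ^ 3 * exp (- x)) / q"
      by simp
    also have "\<dots> \<le> 4 * 6 / q"
      using x3e q by (intro divide_right_mono mult_left_mono) auto
    finally show ?thesis by simp
  qed
  moreover have "\<bar>T * C2 d u\<bar> \<le> 1 * (14 / q)"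
  proof -
    have "\<bar>C2 d u\<bar> = sqrt 3 / 8 * (d * \<bar>u\<bar>)"
      using d0 by (simp add: C2_def abs_mult)
    also have "\<dots> \<le> 1 * (14 / q)"
      using du sqrt3_le d0 by (intro mult_mono) auto
    finally show ?thesis
      unfolding abs_mult using T by (intro mult_mono) auto
  qed
  moreover have "\<bar>C1 d * Qb q d u\<bar> \<le> 1 / q"
  proof -
    have "\<bar>C1 d * Qb q d u\<bar> = C1 d * \<bar>Qb q d u\<bar>"
      using C1 by (simp add: abs_mult)
    also have "\<dots> \<le> C1 d * (x ^ 3 / q)"
      using C1 Q_bounds(2) by (intro mult_left_mono)
    finally show ?thesis
      using C1_Q by linarith
  qed
  ultimately have "\<bar>S * B2 d u + B1 d * (Qa q d u * A) + T * C2 d u + C1 d * Qb q d u\<bar>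
      \<le> 2 * (14 / q) + 24 / q + 1 * (14 / q) + 1 / q"
    by linarith
  also have "\<dots> = 67 / q"
    by (simp flip: add_divide_distrib)
  finally have X2_le: "\<bar>X2\<bar> \<le> 134 / q"
    unfolding X2 abs_mult by simp
  have Y2_le: "\<bar>Y2\<bar> \<le> 3 * (x ^ 3 / q)"
  proof -
    have "\<bar>Qa q d u * S\<bar> \<le> x ^ 3 / q * 2"
      unfolding abs_mult using Q_bounds S2 x0 by (intro mult_mono) auto
    moreover have "\<bar>Qb q d u * T\<bar> \<le> x ^ 3 / q * 1"
      unfolding abs_mult using Q_bounds T x0 by (intro mult_mono) auto
    ultimately show ?thesis
      unfolding Y2 by linarith
  qed
  have X1_le: "\<bar>X1\<bar> \<le> 8 * exp (- x) + 2 * C1 d"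
  proof -
    have "\<bar>S * B1 d\<bar> \<le> 2 * exp (- x) * 2"
      unfolding abs_mult using S B1 by (intro mult_mono) auto
    moreover have "\<bar>T * C1 d\<bar> \<le> 1 * C1 d"
      unfolding abs_mult using T C1 by (intro mult_mono) auto
    ultimately have "\<bar>S * B1 d + T * C1 d\<bar> \<le> 2 * exp (- x) * 2 + 1 * C1 d"
      by linarith
    then show ?thesis
      unfolding X1 abs_mult by simp
  qed
  have "\<bar>X1 * Y2\<bar> \<le> (8 * exp (- x) + 2 * C1 d) * (3 * (x ^ 3 / q))"
    unfolding abs_mult using X1_le Y2_le C1 by (intro mult_mono) auto
  also have "\<dots> = 24 * (x ^ 3 * exp (- x)) / q + 6 * (C1 d * (x ^ 3 / q))"
    by (simp add: algebra_simps)
  also have "\<dots> \<le> 24 * 6 / q + 6 * (1 / q)"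
    using x3e q C1_Q by (intro add_mono divide_right_mono mult_left_mono) auto
  finally have X1Y2: "\<bar>X1 * Y2\<bar> \<le> 150 / q"
    by simp
  have Y1_le: "\<bar>Y1\<bar> \<le> 2" "1 / 2 \<le> \<bar>Y1\<bar>"
    unfolding Y1 using A by linarith+
  have "\<bar>X2 * Y1\<bar> \<le> 134 / q * 2"
    unfolding abs_mult using X2_le Y1_le q by (intro mult_mono) auto
  with X1Y2 have num: "\<bar>X2 * Y1 - X1 * Y2\<bar> \<le> 418 / q"
    by simp
  have "1 / 2 * (1 / 2) \<le> \<bar>Y1\<bar> * \<bar>Y1\<bar>"
    using Y1_le by (intro mult_mono) auto
  then have den: "1 / 4 \<le> Y1\<^sup>2"
    by (simp add: power2_eq_square)
  have "\<bar>(X2 * Y1 - X1 * Y2) / Y1\<^sup>2\<bar> = \<bar>X2 * Y1 - X1 * Y2\<bar> / Y1\<^sup>2"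
    by (simp add: abs_divide)
  also have "\<dots> \<le> (418 / q) / (1 / 4)"
    using num den q by (intro frac_le) auto
  finally show ?thesis
    using q by (simp add: field_simps)
qed

end

section \<open>Asymptotic expansion of the roots\<close>

context window
begin

lemma window_pointI: "\<bar>u\<bar> \<le> pi / 2 \<Longrightarrow> window_point \<sigma> q d u"
  by (intro window_point.intro window_point_axioms.intro window_axioms)

lemma exact_lipschitz:
  "\<bar>a\<bar> \<le> pi / 2 \<Longrightarrow> \<bar>b\<bar> \<le> pi / 2 \<Longrightarrow>
    \<bar>exact_rhs \<sigma> q (d + a / q) - exact_rhs \<sigma> q (d + b / q)\<bar> \<le> 9 / 10 * \<bar>a - b\<bar>"
  by (rule lipschitz_from_derivative_bound[where f = "\<lambda>u. exact_rhs \<sigma> q (d + u / q)"])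
    (blast intro: window_point.exact_rhs_derivative window_pointI)+

lemma model_lipschitz:
  "\<bar>a\<bar> \<le> pi / 2 \<Longrightarrow> \<bar>b\<bar> \<le> pi / 2 \<Longrightarrow>
    \<bar>model_rhs \<sigma> q d a - model_rhs \<sigma> q d b\<bar> \<le> 9 / 10 * \<bar>a - b\<bar>"
  by (rule lipschitz_from_derivative_bound)
    (blast intro: window_point.model_rhs_derivative window_pointI)+

lemma exact_ex1:
  "\<exists>!u. - (pi / 2) < u \<and> u < pi / 2 \<and> u = arctan (exact_rhs \<sigma> q (d + u / q))"
  using exact_lipschitz by (rule arctan_fixed_point_unique) auto

lemma model_ex1:
  "\<exists>!u. - (pi / 2) < u \<and> u < pi / 2 \<and> u = arctan (model_rhs \<sigma> q d u)"
  using model_lipschitz by (rule arctan_fixed_point_unique) auto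

text \<open>By this bound the first coefficient alone determines the root up to O(1/q^3).\<close>

lemma fixed_points_close:
  assumes fix_u: "u = arctan (exact_rhs \<sigma> q (d + u / q))"
    and v: "\<bar>v\<bar> \<le> pi / 2" "v = arctan (model_rhs \<sigma> q d v)"
  shows "\<bar>u - v\<bar> \<le> 3000 / q\<^sup>2"
proof -
  interpret window_point \<sigma> q d v
    using v by unfold_locales
  have "\<bar>exact_rhs \<sigma> q (d + v / q) - model_rhs \<sigma> q d v\<bar> \<le> 300 / q\<^sup>2"
    using v by (intro exact_minus_model_le model_fixed_point_small)
  note close = this
  have "(1 - 9 / 10) * \<bar>u - v\<bar> \<le> 300 / q\<^sup>2"
    by (rule arctan_fixed_points_close[where g = "\<lambda>u. exact_rhs \<sigma> q (d + u / q)" and h = "model_rhs \<sigma> q d",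
          OF _ fix_u v(2) close]) (rule exact_lipschitz)
  then show ?thesis
    by simp
qed

end

lemma correction_le:
  fixes q Z1 Z2 Z3 :: real
  assumes "\<bar>Z2\<bar> \<le> 2000 / q" "Z3 \<le> 9 / 10" "0 < q"
  shows "\<bar>Z2 / (1 + Z1\<^sup>2 - Z3)\<bar> \<le> 20000 / q"
proof -
  have den: "1 / 10 \<le> 1 + Z1\<^sup>2 - Z3"
    using assms(2) zero_le_power2[of Z1] by linarith
  then have "\<bar>Z2 / (1 + Z1\<^sup>2 - Z3)\<bar> = \<bar>Z2\<bar> / (1 + Z1\<^sup>2 - Z3)"
    by (simp add: abs_divide)
  also have "\<dots> \<le> (2000 / q) / (1 / 10)"
    using assms den by (intro frac_le) auto
  finally show ?thesis
    by simp
qed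

context window_point
begin

lemma quotient_cosh_le:
  assumes "\<bar>r\<bar> \<le> 1"
  shows "\<bar>r / cosh (Pb q d u)\<bar> \<le> 2 * exp (- x)" "\<bar>r / cosh (Pb q d u)\<bar> \<le> 1 / 6"
proof -
  have "0 < cosh (Pb q d u)"
    by simp
  then have "\<bar>r / cosh (Pb q d u)\<bar> \<le> 1 / cosh (Pb q d u)"
    using assms by (simp add: abs_divide divide_right_mono)
  with inverse_cosh_le
  show "\<bar>r / cosh (Pb q d u)\<bar> \<le> 2 * exp (- x)" "\<bar>r / cosh (Pb q d u)\<bar> \<le> 1 / 6"
    by linarith+
qed

lemma abs_sinh_over_cosh_le: "\<bar>sinh (Pb q d u) / cosh (Pb q d u)\<bar> \<le> 1"
  using tanh_real_bounds[of "Pb q d u"] unfolding tanh_def[symmetric] by (auto simp: abs_le_iff)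

text \<open>The second coefficient is itself O(1/q), so its term in the expansion is O(1/q^3).\<close>

lemma R_I_le:
  assumes "\<sigma> = 1" and small: "q * d * \<bar>u\<bar> \<le> 14"
  shows "\<bar>R_I q d u\<bar> \<le> 20000 / q"
  unfolding R_I_def
proof (rule correction_le)
  let ?c = "cosh (Pb q d u)"
  have pos: "0 < q * d + u"
    using x_bounds(1) by (simp add: x_def)
  show "Z3_I q d u \<le> 9 / 10"
    using Z1_I_derivative[OF pos] by (rule model_derivative_le) (simp add: Z1_I_eq_model_rhs assms(1))
  show "\<bar>Z2_I q d u\<bar> \<le> 2000 / q"
    unfolding Z2_I_def
  proof (rule second_order_numerator_le[OF small,
          where S = "sin (Pa q d u) / ?c" and A = "cos (Pa q d u) / ?c" and T = "sinh (Pb q d u) / ?c"])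
    show "\<bar>sin (Pa q d u) / ?c\<bar> \<le> 2 * exp (- x)"
      by (rule quotient_cosh_le) simp
    show "\<bar>cos (Pa q d u) / ?c\<bar> \<le> 2 * exp (- x)" "\<bar>cos (Pa q d u) / ?c\<bar> \<le> 1 / 6"
      by (rule quotient_cosh_le; simp)+
  qed (fact abs_sinh_over_cosh_le, simp_all add: X1_I_def X2_I_def Y1_I_def Y2_I_def)
qed (use q_ge in simp)

lemma R_II_le:
  assumes "\<sigma> = - 1" and small: "q * d * \<bar>u\<bar> \<le> 14"
  shows "\<bar>R_II q d u\<bar> \<le> 20000 / q"
  unfolding R_II_def
proof (rule correction_le)
  let ?c = "cosh (Pb q d u)"
  have pos: "0 < q * d + u"
    using x_bounds(1) by (simp add: x_def)
  show "Z3_II q d u \<le> 9 / 10"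
    using minus_Z1_II_derivative[OF pos]
    by (rule model_derivative_le) (simp add: minus_Z1_II_eq_model_rhs assms(1))
  show "\<bar>Z2_II q d u\<bar> \<le> 2000 / q"
    unfolding Z2_II_def
  proof (rule second_order_numerator_le[OF small,
          where S = "- sin (Pa q d u) / ?c" and A = "- cos (Pa q d u) / ?c" and T = "sinh (Pb q d u) / ?c"])
    show "\<bar>- sin (Pa q d u) / ?c\<bar> \<le> 2 * exp (- x)"
      by (rule quotient_cosh_le) simp
    show "\<bar>- cos (Pa q d u) / ?c\<bar> \<le> 2 * exp (- x)" "\<bar>- cos (Pa q d u) / ?c\<bar> \<le> 1 / 6"
      by (rule quotient_cosh_le; simp)+
  qed (fact abs_sinh_over_cosh_le, simp_all add: X1_II_def X2_II_def Y1_II_def Y2_II_def)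
qed (use q_ge in simp)

end

text \<open>The substitution \<phi> = d + u/q maps (-pi/2, pi/2) onto the interval in which the root is
  sought.\<close>

lemma the_affine_eq:
  fixes q d :: real
  assumes ex1: "\<exists>!u. - (pi / 2) < u \<and> u < pi / 2 \<and> Q u" and q: "0 < q"
    and iff: "\<And>u. - (pi / 2) < u \<Longrightarrow> u < pi / 2 \<Longrightarrow> R (d + u / q) \<longleftrightarrow> Q u"
    and lo: "lo = d - pi / 2 / q" and hi: "hi = d + pi / 2 / q"
  obtains u where "- (pi / 2) < u" "u < pi / 2" "Q u" "(THE \<phi>. lo < \<phi> \<and> \<phi> < hi \<and> R \<phi>) = d + u / q"
proof -
  from ex1 obtain u where u: "- (pi / 2) < u \<and> u < pi / 2 \<and> Q u"
    and uniq: "\<forall>v. - (pi / 2) < v \<and> v < pi / 2 \<and> Q v \<longrightarrow> v = u"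
    by (rule ex1E)
  have "(THE \<phi>. lo < \<phi> \<and> \<phi> < hi \<and> R \<phi>) = d + u / q"
  proof (rule the_equality)
    show "lo < d + u / q \<and> d + u / q < hi \<and> R (d + u / q)"
      using u q iff[of u] divide_strict_right_mono[of "- (pi / 2)" u q]
        divide_strict_right_mono[of u "pi / 2" q] unfolding lo hi by simp
  next
    fix \<phi> assume \<phi>: "lo < \<phi> \<and> \<phi> < hi \<and> R \<phi>"
    define v where "v = q * (\<phi> - d)"
    have v: "\<phi> = d + v / q"
      using q by (simp add: v_def)
    have "- (pi / 2) / q < \<phi> - d" "\<phi> - d < pi / 2 / q"
      using \<phi> unfolding lo hi by auto
    then have "- (pi / 2) < v" "v < pi / 2"
      unfolding v_def pos_divide_less_eq[OF q] pos_less_divide_eq[OF q]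
      by (simp_all only: mult.commute)
    moreover from this have "Q v"
      using \<phi> iff[of v] unfolding v by simp
    ultimately have "v = u"
      using uniq by simp
    then show "\<phi> = d + u / q"
      using v by simp
  qed
  then show ?thesis
    using u by (intro that[of u]) simp_all
qed

lemma q_d1: "qn n * d1 n j = real j * pi"
  by (simp add: qn_def d1_def field_simps)

lemma q_d2: "qn n * d2 n j = real j * pi + pi / 2"
  by (simp add: qn_def d2_def field_simps)

lemma qn_pos: "0 < qn n"
  by (simp add: qn_def)

lemma half_step: "pi / 2 / qn n = pi / (real n + 3)"
  by (simp add: qn_def)

lemma eq_arctan_iff: "u = arctan y \<longleftrightarrow> tan u = y" if "- (pi / 2) < u" "u < pi / 2"
  using arctan_unique[OF that] tan_arctan by metis

lemma odd_equation_iff: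
  assumes win: "window 1 (qn n) (d1 n j)" and range: "- (pi / 2) < u" "u < pi / 2"
  shows "tan ((real n + 3) / 2 * (d1 n j + u / qn n)) = f_fun n (d1 n j + u / qn n) \<longleftrightarrow>
    u = arctan (exact_rhs 1 (qn n) (d1 n j + u / qn n))"
proof -
  interpret window_point 1 "qn n" "d1 n j" u
    using win range by (auto intro!: window_point.intro window_point_axioms.intro)
  have arg: "(real n + 3) / 2 * (d1 n j + u / qn n) = u + real j * pi"
    using qn_pos[of n] by (simp add: distrib_left q_d1 flip: qn_def)
  have f: "f_fun n (d1 n j + u / qn n) = exact_rhs 1 (qn n) (d1 n j + u / qn n)"
    unfolding phi_eq using phi_bounds Im_branch_pos by (intro f_fun_eq_exact_rhs)
  show ?thesis
    unfolding arg f tan_periodic_nat using eq_arctan_iff[OF range] by blast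
qed

text \<open>Here q \<phi> = u + pi/2 + j pi, which exchanges sine and cosine: the equation becomes
  - sin u = h cos u, that is, tan u = - h.\<close>

lemma even_equation_iff:
  assumes win: "window (- 1) (qn n) (d2 n j)" and range: "- (pi / 2) < u" "u < pi / 2"
  shows "cos ((real n + 3) / 2 * (d2 n j + u / qn n))
      = h_fun n (d2 n j + u / qn n) * sin ((real n + 3) / 2 * (d2 n j + u / qn n)) \<longleftrightarrow>
    u = arctan (exact_rhs (- 1) (qn n) (d2 n j + u / qn n))"
proof -
  interpret window_point "- 1" "qn n" "d2 n j" u
    using win range by (auto intro!: window_point.intro window_point_axioms.intro)
  let ?h = "h_fun n (d2 n j + u / qn n)"
  have arg: "(real n + 3) / 2 * (d2 n j + u / qn n) = (u + pi / 2) + real j * pi"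
    using qn_pos[of n] by (simp add: distrib_left q_d2 flip: qn_def)
  have trig: "cos ((u + pi / 2) + real j * pi) = (- 1) ^ j * - sin u"
    "sin ((u + pi / 2) + real j * pi) = (- 1) ^ j * cos u"
    by (simp_all add: cos_add sin_add)
  have h: "- ?h = exact_rhs (- 1) (qn n) (d2 n j + u / qn n)"
    unfolding phi_eq using phi_bounds Im_branch_pos by (intro minus_h_fun_eq_exact_rhs)
  have "(- 1) ^ j * - sin u = ?h * ((- 1) ^ j * cos u) \<longleftrightarrow> - sin u = ?h * cos u"
    by (subst mult.left_commute[of ?h], subst mult_left_cancel) auto
  also have "0 < cos u"
    using range by (intro cos_gt_zero_pi) auto
  then have "- sin u = ?h * cos u \<longleftrightarrow> tan u = - ?h"
    by (auto simp: tan_def field_simps)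
  also have "\<dots> \<longleftrightarrow> u = arctan (- ?h)"
    using eq_arctan_iff[OF range] by blast
  finally show ?thesis
    unfolding arg trig h .
qed

lemma expansion_error_le:
  assumes u: "\<bar>u - v\<bar> \<le> 3000 / (qn n)\<^sup>2" and r: "\<bar>r\<bar> \<le> 20000 / qn n" and n: "0 < n"
  shows "\<bar>(d + u / qn n) - (d + 2 * v / (real n + 3) + 4 * r / (real n + 3)\<^sup>2)\<bar> \<le> 184000 / real n ^ 3"
proof -
  let ?q = "qn n"
  have q: "0 < ?q"
    by (rule qn_pos)
  have n3: "real n + 3 = 2 * ?q"
    by (simp add: qn_def)
  have "(d + u / ?q) - (d + 2 * v / (real n + 3) + 4 * r / (real n + 3)\<^sup>2) = (u - v) / ?q - r / ?q\<^sup>2"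
    unfolding n3 by (simp add: power_mult_distrib diff_divide_distrib)
  also have "\<bar>\<dots>\<bar> \<le> \<bar>u - v\<bar> / ?q + \<bar>r\<bar> / ?q\<^sup>2"
    using q abs_triangle_ineq4[of "(u - v) / ?q" "r / ?q\<^sup>2"] by (simp add: abs_divide)
  also have "\<dots> \<le> (3000 / ?q\<^sup>2) / ?q + (20000 / ?q) / ?q\<^sup>2"
    using u r q by (intro add_mono divide_right_mono) auto
  also have "\<dots> = 23000 / ?q ^ 3"
    by (simp add: power2_eq_square power3_eq_cube)
  also have "\<dots> \<le> 23000 / (real n / 2) ^ 3"
    using n q by (intro divide_left_mono power_mono mult_pos_pos) (auto simp: qn_def)
  also have "\<dots> = 184000 / real n ^ 3"
    by (simp add: power_divide)
  finally show ?thesis .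
qed

lemma odd_expansion:
  assumes win: "window 1 (qn n) (d1 n j)" and n: "0 < n" and j: "0 < j"
  shows "\<bar>phi n (2 * j - 1) -
      (d1 n j + 2 * u1_star n j / (real n + 3) + 4 * u2_star n j / (real n + 3)\<^sup>2)\<bar> \<le> 184000 / real n ^ 3"
proof -
  interpret window 1 "qn n" "d1 n j"
    by (rule win)
  have m: "real (2 * j - 1) = 2 * real j - 1" "odd (2 * j - 1)"
    using j by (auto simp: of_nat_diff)
  have lo: "pi * real (2 * j - 1) / (real n + 3) = d1 n j - pi / 2 / qn n"
    and hi: "pi * (real (2 * j - 1) + 2) / (real n + 3) = d1 n j + pi / 2 / qn n"
    unfolding m half_step d1_def by (simp_all add: algebra_simps add_divide_distrib diff_divide_distrib)
  obtain u where fix_u: "u = arctan (exact_rhs 1 (qn n) (d1 n j + u / qn n))"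
    and root: "(THE \<phi>. pi * real (2 * j - 1) / (real n + 3) < \<phi> \<and>
        \<phi> < pi * (real (2 * j - 1) + 2) / (real n + 3) \<and>
        tan ((real n + 3) / 2 * \<phi>) = f_fun n \<phi>) = d1 n j + u / qn n"
    by (rule the_affine_eq[where R = "\<lambda>\<phi>. tan ((real n + 3) / 2 * \<phi>) = f_fun n \<phi>",
          OF exact_ex1 qn_pos odd_equation_iff[OF win] lo hi])
  have phi: "phi n (2 * j - 1) = d1 n j + u / qn n"
    unfolding phi_def using m(2) root by (simp only: not_False_eq_True if_True)
  define v where "v = u1_star n j"
  have "Z1_I (qn n) (d1 n j) u = model_rhs 1 (qn n) (d1 n j) u" if "- (pi / 2) < u" for u
    using that pi_le pi_gt_zero by (intro Z1_I_eq_model_rhs) linarith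
  then have "v = (THE u. - (pi / 2) < u \<and> u < pi / 2 \<and> u = arctan (model_rhs 1 (qn n) (d1 n j) u))"
    unfolding v_def u1_star_def by (simp cong: conj_cong)
  with theI'[OF model_ex1] have v: "- (pi / 2) < v" "v < pi / 2" "v = arctan (model_rhs 1 (qn n) (d1 n j) v)"
    by auto
  interpret window_point 1 "qn n" "d1 n j" v
    using v by unfold_locales auto
  have "\<bar>u2_star n j\<bar> \<le> 20000 / qn n"
    unfolding u2_star_def v_def[symmetric]
    using model_fixed_point_small[OF v(3)] by (intro R_I_le) auto
  moreover have "\<bar>u - v\<bar> \<le> 3000 / (qn n)\<^sup>2"
    using fix_u v by (intro fixed_points_close) auto
  ultimately show ?thesis
    unfolding phi v_def[symmetric] using n by (intro expansion_error_le)
qed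

lemma even_expansion:
  assumes win: "window (- 1) (qn n) (d2 n j)" and n: "0 < n"
  shows "\<bar>phi n (2 * j) -
      (d2 n j + 2 * w1_star n j / (real n + 3) + 4 * w2_star n j / (real n + 3)\<^sup>2)\<bar> \<le> 184000 / real n ^ 3"
proof -
  interpret window "- 1" "qn n" "d2 n j"
    by (rule win)
  have lo: "pi * real (2 * j) / (real n + 3) = d2 n j - pi / 2 / qn n"
    and hi: "pi * (real (2 * j) + 2) / (real n + 3) = d2 n j + pi / 2 / qn n"
    unfolding half_step d2_def by (simp_all add: algebra_simps add_divide_distrib)
  obtain u where fix_u: "u = arctan (exact_rhs (- 1) (qn n) (d2 n j + u / qn n))"
    and root: "(THE \<phi>. pi * real (2 * j) / (real n + 3) < \<phi> \<and>
        \<phi> < pi * (real (2 * j) + 2) / (real n + 3) \<and>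
        cos ((real n + 3) / 2 * \<phi>) = h_fun n \<phi> * sin ((real n + 3) / 2 * \<phi>)) = d2 n j + u / qn n"
    by (rule the_affine_eq[where R = "\<lambda>\<phi>. cos ((real n + 3) / 2 * \<phi>) = h_fun n \<phi> * sin ((real n + 3) / 2 * \<phi>)",
          OF exact_ex1 qn_pos even_equation_iff[OF win] lo hi])
  have "\<not> odd (2 * j)"
    by simp
  with root have phi: "phi n (2 * j) = d2 n j + u / qn n"
    unfolding phi_def by (simp only: if_False)
  define v where "v = w1_star n j"
  have "- arctan (Z1_II (qn n) (d2 n j) u) = arctan (model_rhs (- 1) (qn n) (d2 n j) u)" if "- (pi / 2) < u" for u
  proof -
    have "- Z1_II (qn n) (d2 n j) u = model_rhs (- 1) (qn n) (d2 n j) u"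
      using that pi_le pi_gt_zero by (intro minus_Z1_II_eq_model_rhs) linarith
    then show ?thesis
      by (simp flip: arctan_minus)
  qed
  then have "v = (THE u. - (pi / 2) < u \<and> u < pi / 2 \<and> u = arctan (model_rhs (- 1) (qn n) (d2 n j) u))"
    unfolding v_def w1_star_def by (simp cong: conj_cong)
  with theI'[OF model_ex1] have v: "- (pi / 2) < v" "v < pi / 2" "v = arctan (model_rhs (- 1) (qn n) (d2 n j) v)"
    by auto
  interpret window_point "- 1" "qn n" "d2 n j" v
    using v by unfold_locales auto
  have "\<bar>w2_star n j\<bar> \<le> 20000 / qn n"
    unfolding w2_star_def v_def[symmetric]
    using model_fixed_point_small[OF v(3)] by (intro R_II_le) auto
  moreover have "\<bar>u - v\<bar> \<le> 3000 / (qn n)\<^sup>2"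
    using fix_u v by (intro fixed_points_close) auto
  ultimately show ?thesis
    unfolding phi v_def[symmetric] using n by (intro expansion_error_le)
qed

lemma eventually_log_power_le: "\<forall>\<^sub>F n in sequentially. (10 + ln (2 * (qn n)\<^sup>2)) ^ 5 \<le> qn n"
  unfolding qn_def by real_asymp

text \<open>The hypothesis on j says pi (j - 1) \<le> ln (2 q^2), and both pi j and pi j + pi/2 exceed
  pi (j - 1) by less than 8; this and the summand 2 in the window account for the constant 10.\<close>

lemma window_of_log_bound:
  assumes n: "(10 + ln (2 * (qn n)\<^sup>2)) ^ 5 \<le> qn n" and j: "1 \<le> j"
    and small: "1 / 2 * exp (pi * (real j - 1)) \<le> (qn n)\<^sup>2"
  shows "window 1 (qn n) (d1 n j)" "window (- 1) (qn n) (d2 n j)"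
proof -
  have "ln (exp (pi * (real j - 1))) \<le> ln (2 * (qn n)\<^sup>2)"
    using small qn_pos[of n] by (subst ln_le_cancel_iff) auto
  then have le: "pi * (real j - 1) \<le> ln (2 * (qn n)\<^sup>2)"
    by simp
  have ge: "pi \<le> real j * pi"
    using j by simp
  have bound: "(y + 2) ^ 5 \<le> qn n" if "pi \<le> y" "y \<le> real j * pi + pi / 2" for y
  proof -
    have "y + 2 \<le> 10 + ln (2 * (qn n)\<^sup>2)"
      using that le pi_less_4 unfolding right_diff_distrib mult_1_right mult.commute[of pi] by linarith
    then have "(y + 2) ^ 5 \<le> (10 + ln (2 * (qn n)\<^sup>2)) ^ 5"
      using that pi_gt_zero by (intro power_mono) linarith+
    with n show ?thesis
      by linarith
  qed
  have pos: "0 < pi"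
    by simp
  show "window 1 (qn n) (d1 n j)"
  proof
    show "pi \<le> qn n * d1 n j"
      unfolding q_d1 by (rule ge)
    show "(qn n * d1 n j + 2) ^ 5 \<le> qn n"
      unfolding q_d1 by (rule bound[OF ge]) (use pos in linarith)
  qed simp
  have ge2: "pi \<le> real j * pi + pi / 2"
    using ge pos by linarith
  show "window (- 1) (qn n) (d2 n j)"
  proof
    show "pi \<le> qn n * d2 n j"
      unfolding q_d2 by (rule ge2)
    show "(qn n * d2 n j + 2) ^ 5 \<le> qn n"
      unfolding q_d2 by (rule bound[OF ge2 order_refl])
  qed simp
qed

theorem theorem2p4:
  shows "(\<exists>K::real. \<forall>\<^sub>F n in sequentially. \<forall>j\<in>{1..(n + 1) div 2}.
            1 / 2 * exp (pi * (real j - 1)) \<le> (qn n)\<^sup>2 \<longrightarrow>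
            \<bar>phi n (2 * j - 1) -
               (d1 n j + 2 * u1_star n j / (real n + 3) + 4 * u2_star n j / (real n + 3)\<^sup>2)\<bar>
              \<le> K / real n ^ 3)
       \<and> (\<exists>K::real. \<forall>\<^sub>F n in sequentially. \<forall>j\<in>{1..n div 2}.
            1 / 2 * exp (pi * (real j - 1)) \<le> (qn n)\<^sup>2 \<longrightarrow>
            \<bar>phi n (2 * j) -
               (d2 n j + 2 * w1_star n j / (real n + 3) + 4 * w2_star n j / (real n + 3)\<^sup>2)\<bar>
              \<le> K / real n ^ 3)"
proof (intro conjI exI[of _ 184000])
  show "\<forall>\<^sub>F n in sequentially. \<forall>j\<in>{1..(n + 1) div 2}.
            1 / 2 * exp (pi * (real j - 1)) \<le> (qn n)\<^sup>2 \<longrightarrow>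
            \<bar>phi n (2 * j - 1) -
               (d1 n j + 2 * u1_star n j / (real n + 3) + 4 * u2_star n j / (real n + 3)\<^sup>2)\<bar>
              \<le> 184000 / real n ^ 3"
    using eventually_log_power_le eventually_gt_at_top[of 0]
  proof eventually_elim
    case (elim n)
    then show ?case
      by (intro ballI impI odd_expansion window_of_log_bound(1)) auto
  qed
  show "\<forall>\<^sub>F n in sequentially. \<forall>j\<in>{1..n div 2}.
            1 / 2 * exp (pi * (real j - 1)) \<le> (qn n)\<^sup>2 \<longrightarrow>
            \<bar>phi n (2 * j) -
               (d2 n j + 2 * w1_star n j / (real n + 3) + 4 * w2_star n j / (real n + 3)\<^sup>2)\<bar>
              \<le> 184000 / real n ^ 3"
    using eventually_log_power_le eventually_gt_at_top[of 0]
  proof eventually_elim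
    case (elim n)
    then show ?case
      by (intro ballI impI even_expansion window_of_log_bound(2)) auto
  qed
qed

end
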